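(* Let $n\ge 2$ be an integer and let $q$ be a nonzero complex number with $q^2\ne 1$. Then there is a unique homomorphism of unital associative $\mathbb{C}$-algebras $\varphi: U'_q(\mathrm{so}_n)\to U_q(\mathrm{sl}_n)$ with $$\varphi(I_{i+1,i})=\tilde I_{i+1,i}:=F_i-q\,K_i^{-1}E_i,\qquad i=1,2,\dots,n-1,$$ and $\varphi$ is injective, i.e. it is an isomorphism of $U'_q(\mathrm{so}_n)$ onto the subalgebra $\varphi(U'_q(\mathrm{so}_n))$ of $U_q(\mathrm{sl}_n)$.
   Context: The algebra $U'_q(\mathrm{so}_n)$ (the nonstandard $q$-deformation of $U(\mathrm{so}_n)$) is the unital associative $\mathbb{C}$-algebra generated by elements $I_{21},I_{32},\dots,I_{n,n-1}$ with defining relations $$I_{i,i-1}^2I_{i+1,i}-(q+q^{-1})I_{i,i-1}I_{i+1,i}I_{i,i-1}+I_{i+1,i}I_{i,i-1}^2=-I_{i+1,i},$$ $$I_{i,i-1}I_{i+1,i}^2-(q+q^{-1})I_{i+1,i}I_{i,i-1}I_{i+1,i}+I_{i+1,i}^2I_{i,i-1}=-I_{i,i-1}$$ for $2\le i\le n-1$, and $$I_{i,i-1}I_{j,j-1}-I_{j,j-1}I_{i,i-1}=0\quad\text{for } |i-j|>1.$$ The Drinfeld--Jimbo quantum algebra $U_q(\mathrm{sl}_n)$ is the unital associative $\mathbb{C}$-algebra generated by $E_i,F_i,K_i^{\pm1}$, $i=1,\dots,n-1$ (where $K_i=q^{H_i}$), with relations $K_iK_i^{-1}=K_i^{-1}K_i=1$,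 $K_iK_j=K_jK_i$, $K_iE_jK_i^{-1}=q^{a_{ij}}E_j$, $K_iF_jK_i^{-1}=q^{-a_{ij}}F_j$, $E_iF_j-F_jE_i=\delta_{ij}\frac{K_i-K_i^{-1}}{q-q^{-1}}$, and the $q$-Serre relations $E_iE_j=E_jE_i$, $F_iF_j=F_jF_i$ for $|i-j|>1$, $E_i^2E_j-(q+q^{-1})E_iE_jE_i+E_jE_i^2=0$ and $F_i^2F_j-(q+q^{-1})F_iF_jF_i+F_jF_i^2=0$ for $|i-j|=1$. Here $(a_{ij})$ is the Cartan matrix of $\mathrm{sl}_n$: $a_{ii}=2$, $a_{ij}=-1$ if $|i-j|=1$, and $a_{ij}=0$ otherwise. *)

theory Defs
  imports Complex_Main "HOL-Library.Poly_Mapping" "HOL-Algebra.QuotRing"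
    "HOL-Algebra.Subrings" "HOL-Algebra.Module"
begin

section \<open>Associative unital complex algebras given by generators and relations\<close>

text \<open>
  Multiplication on \<^typ>\<open>'k \<Rightarrow>\<^sub>0 complex\<close> is convolution with respect to \<open>(+)\<close> on
  \<open>'k\<close>. The free monoid is therefore written additively here (concatenation is \<open>(+)\<close>),
  so that finitely supported functions on it form the free associative algebra.
\<close>

datatype 'g free_monoid = Mon (letters: "'g list")

instantiation free_monoid :: (type) monoid_add
begin

definition zero_free_monoid :: "'a free_monoid" where
  "0 = Mon []"

definition plus_free_monoid :: "'a free_monoid \<Rightarrow> 'a free_monoid \<Rightarrow> 'a free_monoid" where
  "u + v = Mon (letters u @ letters v)"

instance
  by standard (simp_all add: zero_free_monoid_def plus_free_monoid_def)

end

type_synonym 'g ncpoly = "'g free_monoid \<Rightarrow>\<^sub>0 complex"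

definition ncvar :: "'g \<Rightarrow> 'g ncpoly" where
  "ncvar g = Poly_Mapping.single (Mon [g]) 1"

definition ncconst :: "complex \<Rightarrow> 'g ncpoly" where
  "ncconst c = Poly_Mapping.single 0 c"

definition free_algebra :: "'g set \<Rightarrow> (complex, 'g ncpoly) module" where
  "free_algebra Gen =
     \<lparr>carrier = {p. \<forall>w \<in> Poly_Mapping.keys p. set (letters w) \<subseteq> Gen},
      mult = (*), one = 1, zero = 0, add = (+), smult = (\<lambda>c p. ncconst c * p)\<rparr>"

text \<open>
  The quotient ring by a two-sided ideal \<open>J\<close> with its induced scalar multiplication. As in
  \<^const>\<open>rcoset_mult\<close>, the result is written as a union over representatives, all of which
  give the same coset.
\<close>

definition quot_algebra :: "(complex, 'a) module \<Rightarrow> 'a set \<Rightarrow> (complex, 'a set) module" where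
  "quot_algebra A J =
     \<lparr>carrier = carrier (A Quot J), mult = monoid.mult (A Quot J), one = one (A Quot J),
      zero = zero (A Quot J), add = add (A Quot J),
      smult = (\<lambda>c S. \<Union>x\<in>S. J +>\<^bsub>A\<^esub> (c \<odot>\<^bsub>A\<^esub> x))\<rparr>"

text \<open>A pair \<open>(l, r)\<close> among the relations stands for the equation \<open>l = r\<close>.\<close>

definition rel_ideal :: "'g set \<Rightarrow> ('g ncpoly \<times> 'g ncpoly) set \<Rightarrow> 'g ncpoly set" where
  "rel_ideal Gen Rel = Idl\<^bsub>free_algebra Gen\<^esub> {l - r | l r. (l, r) \<in> Rel}"

definition presented_algebra ::
    "'g set \<Rightarrow> ('g ncpoly \<times> 'g ncpoly) set \<Rightarrow> (complex, 'g ncpoly set) module" where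
  "presented_algebra Gen Rel = quot_algebra (free_algebra Gen) (rel_ideal Gen Rel)"

definition coset_of ::
    "'g set \<Rightarrow> ('g ncpoly \<times> 'g ncpoly) set \<Rightarrow> 'g ncpoly \<Rightarrow> 'g ncpoly set" where
  "coset_of Gen Rel p = rel_ideal Gen Rel +>\<^bsub>free_algebra Gen\<^esub> p"

definition alg_hom :: "(complex, 'a) module \<Rightarrow> (complex, 'b) module \<Rightarrow> ('a \<Rightarrow> 'b) set" where
  "alg_hom A B =
     {f \<in> ring_hom A B. \<forall>c. \<forall>x \<in> carrier A. f (c \<odot>\<^bsub>A\<^esub> x) = c \<odot>\<^bsub>B\<^esub> f x}"

definition alg_iso :: "(complex, 'a) module \<Rightarrow> (complex, 'b) module \<Rightarrow> ('a \<Rightarrow> 'b) set" where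
  "alg_iso A B = {f \<in> alg_hom A B. bij_betw f (carrier A) (carrier B)}"

definition unital_subalgebra :: "'a set \<Rightarrow> (complex, 'a) module \<Rightarrow> bool" where
  "unital_subalgebra S A \<longleftrightarrow> subring S A \<and> (\<forall>c. \<forall>x \<in> S. c \<odot>\<^bsub>A\<^esub> x \<in> S)"

lemma keys_mult_letters:
  fixes p r :: "'g ncpoly"
  assumes "\<forall>w \<in> Poly_Mapping.keys p. set (letters w) \<subseteq> Gen"
    and "\<forall>w \<in> Poly_Mapping.keys r. set (letters w) \<subseteq> Gen"
  shows "\<forall>w \<in> Poly_Mapping.keys (p * r). set (letters w) \<subseteq> Gen"
  using assms keys_mult[of p r] by (fastforce simp: plus_free_monoid_def)

lemma ring_free_algebra: "ring (free_algebra Gen)"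
proof (rule ringI)
  show "abelian_group (free_algebra Gen)"
  proof (rule abelian_groupI)
    fix p assume p: "p \<in> carrier (free_algebra Gen)"
    then have "- p \<in> carrier (free_algebra Gen)"
      by (simp add: free_algebra_def)
    moreover have "- p \<oplus>\<^bsub>free_algebra Gen\<^esub> p = \<zero>\<^bsub>free_algebra Gen\<^esub>"
      by (simp add: free_algebra_def)
    ultimately show "\<exists>y\<in>carrier (free_algebra Gen). y \<oplus>\<^bsub>free_algebra Gen\<^esub> p = \<zero>\<^bsub>free_algebra Gen\<^esub>"
      by blast
  next
    fix p r assume "p \<in> carrier (free_algebra Gen)" "r \<in> carrier (free_algebra Gen)"
    then show "p \<oplus>\<^bsub>free_algebra Gen\<^esub> r \<in> carrier (free_algebra Gen)"
      using Poly_Mapping.keys_add[of p r] by (auto simp: free_algebra_def)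
  qed (simp_all add: free_algebra_def algebra_simps)
  show "Group.monoid (free_algebra Gen)"
  proof (rule monoidI)
    fix p r assume "p \<in> carrier (free_algebra Gen)" "r \<in> carrier (free_algebra Gen)"
    then show "p \<otimes>\<^bsub>free_algebra Gen\<^esub> r \<in> carrier (free_algebra Gen)"
      using keys_mult_letters[of p Gen r] by (simp add: free_algebra_def)
  qed (simp_all add: free_algebra_def mult.assoc zero_free_monoid_def)
qed (simp_all add: free_algebra_def algebra_simps)

lemma ncvar_in_carrier_iff: "ncvar g \<in> carrier (free_algebra G) \<longleftrightarrow> g \<in> G"
  by (simp add: ncvar_def free_algebra_def)

lemma ncconst_in_carrier: "ncconst c \<in> carrier (free_algebra G)"
  by (simp add: ncconst_def free_algebra_def zero_free_monoid_def)

lemma mult_in_carrier: "p \<in> carrier (free_algebra G) \<Longrightarrow> r \<in> carrier (free_algebra G) \<Longrightarrow> p * r \<in> carrier (free_algebra G)"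
  using keys_mult_letters[of p G r] by (simp add: free_algebra_def)

lemma add_in_carrier: "p \<in> carrier (free_algebra G) \<Longrightarrow> r \<in> carrier (free_algebra G) \<Longrightarrow> p + r \<in> carrier (free_algebra G)"
  using Poly_Mapping.keys_add[of p r] by (auto simp: free_algebra_def)

lemma uminus_in_carrier: "p \<in> carrier (free_algebra G) \<Longrightarrow> - p \<in> carrier (free_algebra G)"
  by (simp add: free_algebra_def)

lemma diff_in_carrier: "p \<in> carrier (free_algebra G) \<Longrightarrow> r \<in> carrier (free_algebra G) \<Longrightarrow> p - r \<in> carrier (free_algebra G)"
  using add_in_carrier[of p G "-r"] uminus_in_carrier[of r G] by simp

lemma zero_one_in_carrier: "0 \<in> carrier (free_algebra G)" "1 \<in> carrier (free_algebra G)"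
  by (simp_all add: free_algebra_def zero_free_monoid_def)

lemmas free_algebra_closed = ncconst_in_carrier mult_in_carrier add_in_carrier uminus_in_carrier diff_in_carrier zero_one_in_carrier

lemma smult_quot_coset: assumes "ideal J (free_algebra G)" "x \<in> carrier (free_algebra G)"
  shows "c \<odot>\<^bsub>quot_algebra (free_algebra G) J\<^esub> (J +>\<^bsub>free_algebra G\<^esub> x) = J +>\<^bsub>free_algebra G\<^esub> (c \<odot>\<^bsub>free_algebra G\<^esub> x)"
proof -
  interpret ideal J "free_algebra G" by fact
  have eq: "c \<odot>\<^bsub>free_algebra G\<^esub> y = ncconst c \<otimes>\<^bsub>free_algebra G\<^esub> y" for y by (simp add: free_algebra_def)
  have cm: "ncconst c \<in> carrier (free_algebra G)" by (rule ncconst_in_carrier)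
  have x: "x \<in> J +>\<^bsub>free_algebra G\<^esub> x" using a_rcos_self assms(2) by simp
  have "J +>\<^bsub>free_algebra G\<^esub> (c \<odot>\<^bsub>free_algebra G\<^esub> y) = J +>\<^bsub>free_algebra G\<^esub> (c \<odot>\<^bsub>free_algebra G\<^esub> x)"
    if y: "y \<in> J +>\<^bsub>free_algebra G\<^esub> x" for y
  proof -
    obtain j where j: "j \<in> J" "y = j \<oplus>\<^bsub>free_algebra G\<^esub> x" using y by (auto simp: a_r_coset_def')
    have "c \<odot>\<^bsub>free_algebra G\<^esub> y = (ncconst c \<otimes>\<^bsub>free_algebra G\<^esub> j) \<oplus>\<^bsub>free_algebra G\<^esub> (c \<odot>\<^bsub>free_algebra G\<^esub> x)"
      unfolding eq j using cm j assms(2) a_Hcarr by (simp add: r_distr)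
    moreover have "ncconst c \<otimes>\<^bsub>free_algebra G\<^esub> j \<in> J" using I_l_closed cm j by simp
    ultimately have "c \<odot>\<^bsub>free_algebra G\<^esub> y \<in> J +>\<^bsub>free_algebra G\<^esub> (c \<odot>\<^bsub>free_algebra G\<^esub> x)"
      by (auto simp: a_r_coset_def')
    moreover have "c \<odot>\<^bsub>free_algebra G\<^esub> x \<in> carrier (free_algebra G)"
      unfolding eq using cm assms(2) by (rule m_closed)
    ultimately show ?thesis by (rule a_repr_independence'[symmetric])
  qed
  then show ?thesis unfolding quot_algebra_def module.simps by (intro UN_constant_eq[OF x]) blast
qed


section \<open>The nonstandard deformation of U(so_n)\<close>

text \<open>\<open>gen_I i j\<close> is only used with \<open>j = i - 1\<close>.\<close>

datatype so_gen = gen_I nat nat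

definition so_gens :: "nat \<Rightarrow> so_gen set" where
  "so_gens n = {gen_I (i + 1) i | i. 1 \<le> i \<and> i \<le> n - 1}"

abbreviation (input) vI :: "nat \<Rightarrow> nat \<Rightarrow> so_gen ncpoly" where
  "vI i j \<equiv> ncvar (gen_I i j)"

definition so_rels :: "nat \<Rightarrow> complex \<Rightarrow> (so_gen ncpoly \<times> so_gen ncpoly) set" where
  "so_rels n q =
     {((vI i (i-1))^2 * vI (i+1) i - ncconst (q + inverse q) * vI i (i-1) * vI (i+1) i * vI i (i-1)
         + vI (i+1) i * (vI i (i-1))^2,
       - vI (i+1) i) | i. 2 \<le> i \<and> i \<le> n - 1}
   \<union> {(vI i (i-1) * (vI (i+1) i)^2 - ncconst (q + inverse q) * vI (i+1) i * vI i (i-1) * vI (i+1) i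
         + (vI (i+1) i)^2 * vI i (i-1),
       - vI i (i-1)) | i. 2 \<le> i \<and> i \<le> n - 1}
   \<union> {(vI i (i-1) * vI j (j-1) - vI j (j-1) * vI i (i-1), 0) | i j.
        i \<in> {2..n} \<and> j \<in> {2..n} \<and> \<bar>int i - int j\<bar> > 1}"

lemma so_rels_in_carrier: "{l - r | l r. (l, r) \<in> so_rels n q} \<subseteq> carrier (free_algebra (so_gens n))"
proof -
  have g: "gen_I i (i - Suc 0) \<in> so_gens n" if "2 \<le> i" "i \<le> n" for i
    using that unfolding so_gens_def by (intro CollectI exI[of _ "i-1"]) auto
  have g': "gen_I (Suc i) i \<in> so_gens n" if "2 \<le> i" "i \<le> n - 1" for i
    using that unfolding so_gens_def by auto
  show ?thesis
    by (auto simp: so_rels_def power2_eq_square intro!: free_algebra_closed g g' simp: ncvar_in_carrier_iff)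
qed

definition Uso :: "nat \<Rightarrow> complex \<Rightarrow> (complex, so_gen ncpoly set) module" where
  "Uso n q = presented_algebra (so_gens n) (so_rels n q)"

definition Uso_I :: "nat \<Rightarrow> complex \<Rightarrow> nat \<Rightarrow> nat \<Rightarrow> so_gen ncpoly set" where
  "Uso_I n q i j = coset_of (so_gens n) (so_rels n q) (vI i j)"


section \<open>The Drinfeld-Jimbo algebra of sl_n\<close>

datatype sl_gen = gen_E nat | gen_F nat | gen_K nat | gen_Kinv nat

definition sl_gens :: "nat \<Rightarrow> sl_gen set" where
  "sl_gens n = (\<Union>i\<in>{1..n-1}. {gen_E i, gen_F i, gen_K i, gen_Kinv i})"

definition cartan :: "nat \<Rightarrow> nat \<Rightarrow> int" where
  "cartan i j = (if i = j then 2 else if \<bar>int i - int j\<bar> = 1 then - 1 else 0)"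

abbreviation (input) vE :: "nat \<Rightarrow> sl_gen ncpoly" where "vE i \<equiv> ncvar (gen_E i)"
abbreviation (input) vF :: "nat \<Rightarrow> sl_gen ncpoly" where "vF i \<equiv> ncvar (gen_F i)"
abbreviation (input) vK :: "nat \<Rightarrow> sl_gen ncpoly" where "vK i \<equiv> ncvar (gen_K i)"
abbreviation (input) vKinv :: "nat \<Rightarrow> sl_gen ncpoly" where "vKinv i \<equiv> ncvar (gen_Kinv i)"

definition sl_rels :: "nat \<Rightarrow> complex \<Rightarrow> (sl_gen ncpoly \<times> sl_gen ncpoly) set" where
  "sl_rels n q = (let N = {1..n-1} in
     {(vK i * vKinv i, 1) | i. i \<in> N}
   \<union> {(vKinv i * vK i, 1) | i. i \<in> N}
   \<union> {(vK i * vK j, vK j * vK i) | i j. i \<in> N \<and> j \<in> N}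
   \<union> {(vK i * vE j * vKinv i, ncconst (q powi cartan i j) * vE j) | i j. i \<in> N \<and> j \<in> N}
   \<union> {(vK i * vF j * vKinv i, ncconst (q powi (- cartan i j)) * vF j) | i j. i \<in> N \<and> j \<in> N}
   \<union> {(vE i * vF j - vF j * vE i,
       if i = j then ncconst (1 / (q - inverse q)) * (vK i - vKinv i) else 0) | i j. i \<in> N \<and> j \<in> N}
   \<union> {(vE i * vE j, vE j * vE i) | i j. i \<in> N \<and> j \<in> N \<and> \<bar>int i - int j\<bar> > 1}
   \<union> {(vF i * vF j, vF j * vF i) | i j. i \<in> N \<and> j \<in> N \<and> \<bar>int i - int j\<bar> > 1}
   \<union> {((vE i)^2 * vE j - ncconst (q + inverse q) * vE i * vE j * vE i + vE j * (vE i)^2, 0) | i j.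
        i \<in> N \<and> j \<in> N \<and> \<bar>int i - int j\<bar> = 1}
   \<union> {((vF i)^2 * vF j - ncconst (q + inverse q) * vF i * vF j * vF i + vF j * (vF i)^2, 0) | i j.
        i \<in> N \<and> j \<in> N \<and> \<bar>int i - int j\<bar> = 1})"

lemma sl_rels_in_carrier: "{l - r | l r. (l, r) \<in> sl_rels n q} \<subseteq> carrier (free_algebra (sl_gens n))"
  unfolding sl_rels_def Let_def
  by (auto simp: power2_eq_square ncvar_in_carrier_iff sl_gens_def intro!: free_algebra_closed simp del: One_nat_def)

definition Usl :: "nat \<Rightarrow> complex \<Rightarrow> (complex, sl_gen ncpoly set) module" where
  "Usl n q = presented_algebra (sl_gens n) (sl_rels n q)"

definition Usl_E :: "nat \<Rightarrow> complex \<Rightarrow> nat \<Rightarrow> sl_gen ncpoly set" where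
  "Usl_E n q i = coset_of (sl_gens n) (sl_rels n q) (vE i)"

definition Usl_F :: "nat \<Rightarrow> complex \<Rightarrow> nat \<Rightarrow> sl_gen ncpoly set" where
  "Usl_F n q i = coset_of (sl_gens n) (sl_rels n q) (vF i)"

definition Usl_Kinv :: "nat \<Rightarrow> complex \<Rightarrow> nat \<Rightarrow> sl_gen ncpoly set" where
  "Usl_Kinv n q i = coset_of (sl_gens n) (sl_rels n q) (vKinv i)"

text \<open>\<open>I_tilde n q i\<close> is the element with index \<open>(i + 1, i)\<close>.\<close>

definition I_tilde :: "nat \<Rightarrow> complex \<Rightarrow> nat \<Rightarrow> sl_gen ncpoly set" where
  "I_tilde n q i =
     Usl_F n q i \<ominus>\<^bsub>Usl n q\<^esub> q \<odot>\<^bsub>Usl n q\<^esub> (Usl_Kinv n q i \<otimes>\<^bsub>Usl n q\<^esub> Usl_E n q i)"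

end

theory Submission
  imports Defs
begin

text \<open>
  The free algebra \<open>M\<close> on letters \<open>x\<^sub>i\<close> (one for each \<open>I\<^bsub>i+1,i\<^esub>\<close>) is a Verma-like module
  of highest weight \<open>0\<close>: \<open>F\<^sub>i\<close> multiplies by \<open>x\<^sub>i\<close>, \<open>K\<^sub>i\<close> is diagonal, \<open>E\<^sub>i\<close> kills \<open>1\<close>.
  All relations of the quantum algebra hold on \<open>M\<close>, except that those between the \<open>F\<^sub>i\<close> only hold
  modulo the ideal \<open>S\<close> of the \<open>q\<close>-Serre elements, and \<open>S\<close> is a submodule. Since \<open>E\<^sub>i\<close> lowers the
  degree, sending \<open>I\<^bsub>i+1,i\<^esub>\<close> to \<open>F\<^sub>i - q K\<^sub>i\<inverse> E\<^sub>i\<close> and applying the result to \<open>1\<close> gives a map \<open>T\<close> that fixes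
  leading terms. If \<open>x\<close> is mapped to \<open>0\<close> in the quantum algebra, then \<open>T x\<close> lies
  in \<open>S\<close>, and since \<open>S\<close> is homogeneous so does the leading term of \<open>x\<close>. The \<open>q\<close>-Serre elements are
  the leading terms of the defining relations of the orthogonal algebra, so \<open>x\<close> can be replaced by an
  element of lower degree with the same coset; induct on the degree.
\<close>

section \<open>Linear maps on free algebras\<close>

definition sc :: "complex \<Rightarrow> 'g ncpoly \<Rightarrow> 'g ncpoly" where
  "sc c p = ncconst c * p"

definition word :: "'g list \<Rightarrow> 'g ncpoly" where
  "word w = Poly_Mapping.single (Mon w) 1"

lemma sc_single: "sc c (Poly_Mapping.single w d) = Poly_Mapping.single w (c * d)"
  by (simp add: sc_def ncconst_def mult_single)

lemma ncpoly_single_induct [case_names zero add]: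
  fixes p :: "'g ncpoly"
  assumes "P 0" and "\<And>p w c. P p \<Longrightarrow> P (p + Poly_Mapping.single w c)"
  shows "P p"
proof (induction p rule: update_induct)
  case const
  then show ?case by (rule assms(1))
next
  case (update f a b)
  have "Poly_Mapping.update a b f = f + Poly_Mapping.single a b"
    using update.hyps by (intro poly_mapping_eqI)
      (auto simp: lookup_update lookup_add lookup_single when_def in_keys_iff)
  then show ?case using assms(2)[OF update.IH] by simp
qed

lemma sc_add: "sc c (p + r) = sc c p + sc c r"
  by (simp add: sc_def distrib_left)

lemma lookup_sc: "Poly_Mapping.lookup (sc c p) w = c * Poly_Mapping.lookup p w"
proof (induction p rule: ncpoly_single_induct)
  case zero
  then show ?case by (simp add: sc_def)
next
  case (add p u d)
  then show ?case
    by (simp add: sc_add sc_single lookup_add lookup_single when_def distrib_left)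
qed

interpretation sc: vector_space sc
  by unfold_locales
    (auto intro!: poly_mapping_eqI simp: lookup_sc lookup_add algebra_simps)

lemma sc_mult_left: "sc c p * r = sc c (p * r)"
  by (simp add: sc_def mult.assoc)

text \<open>\<open>sc\<close> multiplies by a constant from the left, so the point is that constants
  are central; this is checked on single terms.\<close>

lemma sc_mult_right: "p * sc c r = sc c (p * r)"
proof -
  have "p * ncconst c = sc c p"
  proof (induction p rule: ncpoly_single_induct)
    case (add p w d)
    have "Poly_Mapping.single w d * ncconst c = sc c (Poly_Mapping.single w d)"
      by (simp add: sc_single) (simp add: ncconst_def mult_single mult.commute)
    with add show ?case by (simp add: distrib_right sc_add)
  qed simp
  then show ?thesis by (simp add: sc_def flip: mult.assoc)
qed

lemmas sc_simps = sc_mult_left sc_mult_right sc.scale_right_distrib sc.scale_right_diff_distrib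
  sc.scale_minus_right sc.scale_scale

lemma ncconst_eq_sc: "ncconst c = sc c 1"
  by (simp add: sc_def)

lemma word_Nil: "word [] = 1"
  by (simp add: word_def flip: zero_free_monoid_def single_one)

lemma word_append: "word (u @ v) = word u * word v"
  by (simp add: word_def mult_single plus_free_monoid_def)

lemma word_Cons: "word (g # w) = ncvar g * word w"
  by (simp add: word_def ncvar_def mult_single plus_free_monoid_def)

lemma ncvar_eq_word: "ncvar g = word [g]"
  by (simp add: word_def ncvar_def)

lemma keys_word [simp]: "Poly_Mapping.keys (word w) = {Mon w}"
  by (simp add: word_def)

lemma keys_sc: "Poly_Mapping.keys (sc c p) \<subseteq> Poly_Mapping.keys p"
  by (auto simp: in_keys_iff lookup_sc)

lemma ncpoly_expand: "p = (\<Sum>w\<in>Poly_Mapping.keys p. sc (Poly_Mapping.lookup p w) (word (letters w)))"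
  by (intro poly_mapping_eqI)
    (simp add: lookup_sum lookup_sc word_def lookup_single when_def in_keys_iff
      if_distrib[of "\<lambda>x. _ * x"] sum.delta cong: if_cong)

text \<open>The word case ranges only over words that occur in \<open>p\<close>, so bounds on the
  letters or lengths of all words of \<open>p\<close> are at hand there.\<close>

lemma ncpoly_induct [case_names zero add word]:
  assumes "P 0" and "\<And>p r. P p \<Longrightarrow> P r \<Longrightarrow> P (p + r)"
    and "\<And>c w. Mon w \<in> Poly_Mapping.keys p \<Longrightarrow> P (sc c (word w))"
  shows "P p"
proof -
  have "P (\<Sum>w\<in>A. sc (Poly_Mapping.lookup p w) (word (letters w)))"
    if "finite A" "A \<subseteq> Poly_Mapping.keys p" for A
    using that
  proof (induction A)
    case (insert w A)
    then have "Mon (letters w) \<in> Poly_Mapping.keys p" by simp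
    with insert show ?case by (simp add: assms(2,3))
  qed (simp add: assms(1))
  then show ?thesis using ncpoly_expand[of p] by (metis finite_keys order_refl)
qed

section \<open>Linear maps between free algebras and actions given on letters\<close>

abbreviation linop :: "('g ncpoly \<Rightarrow> 'h ncpoly) \<Rightarrow> bool" where
  "linop \<equiv> module_hom sc sc"

lemma linopI:
  assumes "\<And>p r. f (p + r) = f p + f r" and "\<And>c p. f (sc c p) = sc c (f p)"
  shows "linop f"
  using assms by (simp add: module_hom_iff sc.module_axioms)

lemma linop_ext:
  assumes "linop f" "linop g" "\<And>w. f (word w) = g (word w)"
  shows "f p = g p"
  by (induction p rule: ncpoly_induct)
    (simp_all add: assms module_hom.zero[OF assms(1)] module_hom.zero[OF assms(2)]
      module_hom.add[OF assms(1)] module_hom.add[OF assms(2)]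
      module_hom.scale[OF assms(1)] module_hom.scale[OF assms(2)])

lemma linop_compose: "linop f \<Longrightarrow> linop g \<Longrightarrow> linop (\<lambda>p. f (g p))"
  by (auto simp: module_hom_iff)

lemma linop_add: "linop f \<Longrightarrow> linop g \<Longrightarrow> linop (\<lambda>p. f p + g p)"
  by (intro linopI) (simp_all add: module_hom.add module_hom.scale sc_simps)

lemma linop_diff: "linop f \<Longrightarrow> linop g \<Longrightarrow> linop (\<lambda>p. f p - g p)"
  by (intro linopI) (simp_all add: module_hom.add module_hom.scale sc_simps)

lemma linop_sc: "linop f \<Longrightarrow> linop (\<lambda>p. sc c (f p))"
  by (intro linopI) (simp_all add: module_hom.add module_hom.scale sc_simps mult.commute)

lemma linop_mult_left: "linop f \<Longrightarrow> linop (\<lambda>p. a * f p)"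
  by (intro linopI) (simp_all add: module_hom.add module_hom.scale sc_simps distrib_left)

lemma linop_mult_right: "linop f \<Longrightarrow> linop (\<lambda>p. f p * a)"
  by (intro linopI) (simp_all add: module_hom.add module_hom.scale sc_simps distrib_right)

lemma linop_ident: "linop (\<lambda>p. p)"
  by (intro linopI) simp_all

lemma linop_zero: "linop (\<lambda>p. 0)"
  by (intro linopI) simp_all

lemmas linop_intros = linop_add linop_diff linop_sc linop_mult_left linop_mult_right linop_ident linop_zero

definition lin :: "('g list \<Rightarrow> 'h ncpoly) \<Rightarrow> 'g ncpoly \<Rightarrow> 'h ncpoly" where
  "lin h p = (\<Sum>w\<in>Poly_Mapping.keys p. sc (Poly_Mapping.lookup p w) (h (letters w)))"

text \<open>One common finite index set makes sums comparable when the supports of two elements and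
  of their sum differ.\<close>

lemma lin_superset:
  assumes "finite A" "Poly_Mapping.keys p \<subseteq> A"
  shows "lin h p = (\<Sum>w\<in>A. sc (Poly_Mapping.lookup p w) (h (letters w)))"
  unfolding lin_def using assms by (intro sum.mono_neutral_left) (auto simp: in_keys_iff)

lemma linop_lin: "linop (lin h)"
proof (rule linopI)
  fix p r :: "'a ncpoly" and c :: complex
  let ?A = "Poly_Mapping.keys p \<union> Poly_Mapping.keys r"
  have A: "finite ?A" "Poly_Mapping.keys p \<subseteq> ?A" "Poly_Mapping.keys r \<subseteq> ?A" by auto
  have "Poly_Mapping.keys (p + r) \<subseteq> ?A" by (rule Poly_Mapping.keys_add)
  then show "lin h (p + r) = lin h p + lin h r"
    by (simp add: lin_superset[OF A(1)] A lookup_add sc.scale_left_distrib sum.distrib)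
  show "lin h (sc c p) = sc c (lin h p)"
    unfolding lin_superset[OF finite_keys keys_sc] by (simp add: lookup_sc lin_superset[OF finite_keys order_refl]
        sc.scale_sum_right)
qed

lemma lin_word: "lin h (word w) = h w"
  by (simp add: lin_def word_def)

text \<open>Operators \<open>f g\<close>, one for each letter, turn the target into a module over
  the free algebra: \<open>foldr\<close> composes them, rightmost letter first. For linear
  \<open>f g\<close>, \<open>act_mult\<close> is the module law.\<close>

definition act :: "('g \<Rightarrow> 'h ncpoly \<Rightarrow> 'h ncpoly) \<Rightarrow> 'g ncpoly \<Rightarrow> 'h ncpoly \<Rightarrow> 'h ncpoly" where
  "act f p m = lin (\<lambda>w. foldr f w m) p"

lemma linop_act: "linop (\<lambda>p. act f p m)"
  by (simp add: act_def linop_lin)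

lemmas act_linear = module_hom.add[OF linop_act] module_hom.scale[OF linop_act]
  module_hom.diff[OF linop_act] module_hom.neg[OF linop_act] module_hom.zero[OF linop_act]

lemma act_word: "act f (word w) m = foldr f w m"
  by (simp add: act_def lin_word)

lemma act_ncvar: "act f (ncvar g) m = f g m"
  by (simp add: ncvar_eq_word act_word)

lemma act_one: "act f 1 m = m"
  using act_word[of f "[]"] by (simp add: word_Nil)

lemma linop_act_arg:
  assumes "\<And>g. linop (f g)"
  shows "linop (act f p)"
proof (induction p rule: ncpoly_induct)
  case zero
  then show ?case by (simp add: act_linear linop_zero)
next
  case (add p r)
  then show ?case by (simp add: act_linear linop_add)
next
  case (word c w)
  have "linop (foldr f w)"
  proof (induction w)
    case (Cons g w)
    then show ?case using linop_compose[OF assms] by (simp add: comp_def)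
  qed (simp add: linop_ident id_def)
  then show ?case by (simp add: act_linear act_word linop_sc)
qed

lemma act_mult:
  assumes "\<And>g. linop (f g)"
  shows "act f (p * r) m = act f p (act f r m)"
proof -
  have "act f (word u * r) m = act f (word u) (act f r m)" for u
  proof (rule linop_ext[of "\<lambda>r. act f (word u * r) m"])
    show "linop (\<lambda>r. act f (word u) (act f r m))"
      by (intro linop_compose[OF linop_act_arg] linop_act assms)
    show "linop (\<lambda>r. act f (word u * r) m)"
      by (rule linop_compose[OF linop_act]) (intro linop_intros)
  qed (simp add: act_word flip: word_append)
  then show ?thesis
    by (rule linop_ext[of "\<lambda>p. act f (p * r) m", rotated -1])
      (rule linop_compose[OF linop_act] linop_act | intro linop_intros)+
qed

text \<open>Letting \<open>h g\<close> act by left multiplication and evaluating at 1 gives the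
  algebra homomorphism that extends \<open>h\<close>.\<close>

definition subst :: "('g \<Rightarrow> 'h ncpoly) \<Rightarrow> 'g ncpoly \<Rightarrow> 'h ncpoly" where
  "subst h p = act (\<lambda>g. (*) (h g)) p 1"

lemma linop_subst: "linop (subst h)"
  unfolding subst_def[abs_def] by (rule linop_act)

lemma subst_mult: "subst h (p * r) = subst h p * subst h r"
proof -
  have lo: "\<And>g. linop ((*) (h g))" by (intro linop_intros)
  \<comment> \<open>Left multiplications commute with right multiplications, so this action is
    determined by its value at 1.\<close>
  have "act (\<lambda>g. (*) (h g)) p m = act (\<lambda>g. (*) (h g)) p 1 * m" for m
  proof (rule linop_ext[of "\<lambda>p. act (\<lambda>g. (*) (h g)) p m"])
    show "act (\<lambda>g. (*) (h g)) (word w) m = act (\<lambda>g. (*) (h g)) (word w) 1 * m" for w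
      by (induction w) (simp_all add: act_word mult.assoc)
  qed (intro linop_act linop_intros)+
  then show ?thesis using act_mult[of "\<lambda>g. (*) (h g)", OF lo] by (metis subst_def)
qed

lemmas subst_linear = module_hom.add[OF linop_subst] module_hom.scale[OF linop_subst]
  module_hom.diff[OF linop_subst] module_hom.neg[OF linop_subst] module_hom.zero[OF linop_subst]

lemma subst_ncvar: "subst h (ncvar g) = h g"
  by (simp add: subst_def act_ncvar)

lemma subst_one: "subst h 1 = 1"
  by (simp add: subst_def act_one)

lemmas subst_simps = subst_mult subst_linear subst_ncvar subst_one

lemma sc_in_carrier: "p \<in> carrier (free_algebra G) \<Longrightarrow> sc c p \<in> carrier (free_algebra G)"
  by (simp add: sc_def free_algebra_closed)

lemma word_in_carrier_iff: "word w \<in> carrier (free_algebra G) \<longleftrightarrow> set w \<subseteq> G"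
  by (simp add: free_algebra_def)

lemmas carrier_intros = free_algebra_closed sc_in_carrier ncvar_in_carrier_iff[THEN iffD2]
  word_in_carrier_iff[THEN iffD2]

lemma carrier_induct [consumes 1, case_names zero add word]:
  assumes "p \<in> carrier (free_algebra G)" and "P 0" and "\<And>p r. P p \<Longrightarrow> P r \<Longrightarrow> P (p + r)"
    and "\<And>c w. set w \<subseteq> G \<Longrightarrow> P (sc c (word w))"
  shows "P p"
proof (induction p rule: ncpoly_induct)
  case zero
  show ?case by (rule assms(2))
next
  case (add p r)
  then show ?case by (rule assms(3))
next
  case (word c w)
  have "\<forall>w\<in>Poly_Mapping.keys p. set (letters w) \<subseteq> G"
    using assms(1) by (simp add: free_algebra_def)
  from bspec[OF this word(1)] show ?case by (intro assms(4)) simp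
qed

text \<open>Applying the letters of a word one by one and then combining linearly never leaves
  \<open>X\<close>. This gives both that carriers are preserved and that the ideal \<open>S\<close>
  is a submodule.\<close>

lemma act_closed:
  assumes "p \<in> carrier (free_algebra G)"
    and "0 \<in> X" "\<And>x y. x \<in> X \<Longrightarrow> y \<in> X \<Longrightarrow> x + y \<in> X" "\<And>c x. x \<in> X \<Longrightarrow> sc c x \<in> X"
    and "\<And>g x. g \<in> G \<Longrightarrow> x \<in> X \<Longrightarrow> f g x \<in> X" and "m \<in> X"
  shows "act f p m \<in> X"
  using assms(1)
proof (induction p rule: carrier_induct)
  case (word c w)
  then have "foldr f w m \<in> X" by (induction w) (auto intro: assms)
  then show ?case by (simp add: act_linear act_word assms)
qed (simp_all add: act_linear assms)

lemma subst_in_carrier: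
  assumes "p \<in> carrier (free_algebra G)" and "\<And>g. g \<in> G \<Longrightarrow> h g \<in> carrier (free_algebra G')"
  shows "subst h p \<in> carrier (free_algebra G')"
  unfolding subst_def by (rule act_closed[OF assms(1)]) (auto intro: carrier_intros assms(2))

section \<open>Degree and homogeneous parts\<close>

definition homogeneous_part :: "nat \<Rightarrow> 'g ncpoly \<Rightarrow> 'g ncpoly" where
  "homogeneous_part d = lin (\<lambda>w. if length w = d then word w else 0)"

text \<open>The bound is strict so that bound 0 leaves only the zero polynomial, which starts the
  induction on the degree.\<close>

definition degree_less :: "nat \<Rightarrow> 'g ncpoly set" where
  "degree_less d = {p. \<forall>w\<in>Poly_Mapping.keys p. length (letters w) < d}"

lemma homogeneous_part_linear:
  "homogeneous_part d (x + y) = homogeneous_part d x + homogeneous_part d y"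
  "homogeneous_part d (x - y) = homogeneous_part d x - homogeneous_part d y"
  "homogeneous_part d (sc c x) = sc c (homogeneous_part d x)" "homogeneous_part d 0 = 0"
  unfolding homogeneous_part_def
  by (simp_all add: module_hom.add[OF linop_lin] module_hom.diff[OF linop_lin]
      module_hom.scale[OF linop_lin] module_hom.zero[OF linop_lin])

lemma homogeneous_part_word:
  "homogeneous_part d (word w) = (if length w = d then word w else 0)"
  by (simp add: homogeneous_part_def lin_word)

lemma degree_less_zero: "0 \<in> degree_less d"
  by (simp add: degree_less_def)

lemma degree_less_add: "x \<in> degree_less d \<Longrightarrow> y \<in> degree_less d \<Longrightarrow> x + y \<in> degree_less d"
  using Poly_Mapping.keys_add[of x y] by (auto simp: degree_less_def)

lemma degree_less_sc: "x \<in> degree_less d \<Longrightarrow> sc c x \<in> degree_less d"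
  using keys_sc[of c x] by (auto simp: degree_less_def)

lemma degree_less_diff: "x \<in> degree_less d \<Longrightarrow> y \<in> degree_less d \<Longrightarrow> x - y \<in> degree_less d"
  using degree_less_add[of x d "- y"] degree_less_sc[of y d "- 1"] by simp

lemma degree_less_word: "word w \<in> degree_less d \<longleftrightarrow> length w < d"
  by (simp add: degree_less_def)

lemma degree_less_mono: "x \<in> degree_less d \<Longrightarrow> d \<le> d' \<Longrightarrow> x \<in> degree_less d'"
  by (fastforce simp: degree_less_def)

lemma degree_less_induct [consumes 1, case_names zero add word]:
  assumes "x \<in> degree_less d" and "P 0" and "\<And>x y. P x \<Longrightarrow> P y \<Longrightarrow> P (x + y)"
    and "\<And>c w. length w < d \<Longrightarrow> P (sc c (word w))"
  shows "P x"
proof (induction x rule: ncpoly_induct)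
  case zero
  show ?case by (rule assms(2))
next
  case (add x y)
  then show ?case by (rule assms(3))
next
  case (word c w)
  then show ?case using assms(1) by (intro assms(4)) (auto simp: degree_less_def)
qed

lemma degree_less_0: "x \<in> degree_less 0 \<Longrightarrow> x = 0"
  by (induction x rule: degree_less_induct) simp_all

lemma diff_homogeneous_part:
  "x \<in> degree_less (Suc d) \<Longrightarrow> x - homogeneous_part d x \<in> degree_less d"
proof (induction x rule: degree_less_induct)
  case (add x y)
  then show ?case
    using degree_less_add[OF add] by (simp add: homogeneous_part_linear algebra_simps)
next
  case (word c w)
  then show ?case
    by (auto simp: homogeneous_part_linear homogeneous_part_word degree_less_zero
        intro!: degree_less_sc degree_less_word[THEN iffD2])
qed (simp_all add: homogeneous_part_linear degree_less_zero)

lemma degree_less_ncvar_mult: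
  "x \<in> degree_less d \<Longrightarrow> ncvar g * x \<in> degree_less (Suc d)"
  by (induction x rule: degree_less_induct)
    (simp_all add: distrib_left degree_less_zero degree_less_add sc_simps degree_less_sc
      degree_less_word flip: word_Cons)

section \<open>Algebras given by generators and relations\<close>

lemma free_algebra_ops [simp]:
  "x \<otimes>\<^bsub>free_algebra G\<^esub> y = x * y" "x \<oplus>\<^bsub>free_algebra G\<^esub> y = x + y"
  "\<one>\<^bsub>free_algebra G\<^esub> = 1" "\<zero>\<^bsub>free_algebra G\<^esub> = 0" "c \<odot>\<^bsub>free_algebra G\<^esub> x = sc c x"
  by (simp_all add: free_algebra_def sc_def)

section \<open>The ideal of relations and the quotient by it\<close>

locale presentation =
  fixes Gen :: "'g set" and Rel :: "('g ncpoly \<times> 'g ncpoly) set"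
  assumes rels_in_carrier: "{l - r | l r. (l, r) \<in> Rel} \<subseteq> carrier (free_algebra Gen)"
begin

abbreviation "C \<equiv> carrier (free_algebra Gen)"
abbreviation "J \<equiv> rel_ideal Gen Rel"

sublocale free: ring "free_algebra Gen"
  by (rule ring_free_algebra)

sublocale J: ideal J "free_algebra Gen"
  unfolding rel_ideal_def by (rule free.genideal_ideal[OF rels_in_carrier])

lemma rel_in_J: "(l, r) \<in> Rel \<Longrightarrow> l - r \<in> J"
  unfolding rel_ideal_def using free.genideal_self[OF rels_in_carrier] by blast

lemma J_in_carrier: "x \<in> J \<Longrightarrow> x \<in> C"
  by (rule J.Icarr)

lemma J_zero: "0 \<in> J"
  using J.zero_closed by simp

lemma J_add: "x \<in> J \<Longrightarrow> y \<in> J \<Longrightarrow> x + y \<in> J"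
  using J.a_closed by simp

lemma J_mult_left: "a \<in> C \<Longrightarrow> x \<in> J \<Longrightarrow> a * x \<in> J"
  using J.I_l_closed by simp

lemma J_mult_right: "a \<in> C \<Longrightarrow> x \<in> J \<Longrightarrow> x * a \<in> J"
  using J.I_r_closed by simp

lemma J_sc: "x \<in> J \<Longrightarrow> sc c x \<in> J"
  unfolding sc_def by (rule J_mult_left[OF ncconst_in_carrier])

lemma J_uminus: "x \<in> J \<Longrightarrow> - x \<in> J"
  using J_sc[of x "- 1"] by simp

lemma J_diff: "x \<in> J \<Longrightarrow> y \<in> J \<Longrightarrow> x - y \<in> J"
  using J_add[of x "- y"] J_uminus by simp

lemma J_minimal:
  assumes "X \<subseteq> C" and "0 \<in> X" and "\<And>x y. x \<in> X \<Longrightarrow> y \<in> X \<Longrightarrow> x + y \<in> X"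
    and "\<And>a x. a \<in> C \<Longrightarrow> x \<in> X \<Longrightarrow> a * x \<in> X" and "\<And>a x. a \<in> C \<Longrightarrow> x \<in> X \<Longrightarrow> x * a \<in> X"
    and "\<And>l r. (l, r) \<in> Rel \<Longrightarrow> l - r \<in> X"
  shows "J \<subseteq> X"
  unfolding rel_ideal_def
proof (rule free.genideal_minimal)
  have "subgroup X (add_monoid (free_algebra Gen))"
  proof (rule free.add.subgroupI)
    show "\<ominus>\<^bsub>free_algebra Gen\<^esub> x \<in> X" if "x \<in> X" for x
    proof -
      \<comment> \<open>Closure under negation comes from multiplying by the constant -1.\<close>
      have "- x \<in> X" using assms(4)[of "- 1" x] that by (simp add: carrier_intros)
      moreover have "\<ominus>\<^bsub>free_algebra Gen\<^esub> x = - x"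
        using that assms(1) uminus_in_carrier[of x Gen]
        by (intro free.minus_equality) auto
      ultimately show ?thesis by simp
    qed
  qed (use assms in auto)
  then show "ideal X (free_algebra Gen)"
    by (intro idealI free.ring_axioms) (use assms in auto)
qed (use assms(6) in blast)

lemma J_sub_closed: "x - y \<in> J \<Longrightarrow> y \<in> J \<Longrightarrow> x \<in> J"
  using J_add[of "x - y" y] by simp

abbreviation "coset \<equiv> coset_of Gen Rel"
abbreviation "Q \<equiv> presented_algebra Gen Rel"

lemma coset_eq_iff:
  assumes "p \<in> C" "r \<in> C"
  shows "coset p = coset r \<longleftrightarrow> p - r \<in> J"
proof
  assume "coset p = coset r"
  then have "p \<in> J +>\<^bsub>free_algebra Gen\<^esub> r"
    using J.a_rcos_self[OF assms(1)] by (simp add: coset_of_def)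
  then obtain j where "j \<in> J" "p = j + r" by (auto simp: a_r_coset_def')
  then show "p - r \<in> J" by simp
next
  assume "p - r \<in> J"
  then have "p \<in> J +>\<^bsub>free_algebra Gen\<^esub> r"
    by (auto simp: a_r_coset_def' intro!: bexI[of _ "p - r"])
  then show "coset p = coset r"
    unfolding coset_of_def using J.a_repr_independence'[OF _ assms(2)] by simp
qed

lemma carrier_presented: "carrier Q = coset ` C"
  by (auto simp: presented_algebra_def quot_algebra_def FactRing_def A_RCOSETS_def' coset_of_def)

lemma coset_in_carrier: "p \<in> C \<Longrightarrow> coset p \<in> carrier Q"
  by (simp add: carrier_presented)

lemma coset_mult: "p \<in> C \<Longrightarrow> r \<in> C \<Longrightarrow> coset p \<otimes>\<^bsub>Q\<^esub> coset r = coset (p * r)"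
  using J.rcoset_mult_add[of p r]
  by (simp add: presented_algebra_def quot_algebra_def FactRing_def coset_of_def)

lemma coset_add: "p \<in> C \<Longrightarrow> r \<in> C \<Longrightarrow> coset p \<oplus>\<^bsub>Q\<^esub> coset r = coset (p + r)"
  using J.a_rcos_sum[of p r]
  by (simp add: presented_algebra_def quot_algebra_def FactRing_def coset_of_def)

lemma coset_one: "\<one>\<^bsub>Q\<^esub> = coset 1"
  by (simp add: presented_algebra_def quot_algebra_def FactRing_def coset_of_def)

lemma coset_zero: "\<zero>\<^bsub>Q\<^esub> = coset 0"
  using J.a_rcos_const[of 0] J_zero
  by (simp add: presented_algebra_def quot_algebra_def FactRing_def coset_of_def)

lemma coset_smult: "p \<in> C \<Longrightarrow> c \<odot>\<^bsub>Q\<^esub> coset p = coset (sc c p)"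
  using smult_quot_coset[OF J.ideal_axioms, of p c]
  by (simp add: presented_algebra_def coset_of_def)

text \<open>The record also holds a scalar multiplication, so it is not literally the quotient ring;
  as the ring fields agree, the axioms carry over.\<close>

lemma ring_presented: "ring Q"
proof -
  interpret F: ring "free_algebra Gen Quot J"
    by (rule J.quotient_is_ring)
  have "carrier Q = carrier (free_algebra Gen Quot J)" "mult Q = mult (free_algebra Gen Quot J)"
    "one Q = one (free_algebra Gen Quot J)" "zero Q = zero (free_algebra Gen Quot J)"
    "add Q = add (free_algebra Gen Quot J)"
    by (simp_all add: presented_algebra_def quot_algebra_def)
  then show ?thesis
    by (intro ringI abelian_groupI monoidI)
      (auto simp: F.ring_simprules intro: F.a_closed F.m_closed
        dest: F.add.l_inv_ex)
qed

lemma coset_minus: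
  assumes "p \<in> C" "r \<in> C"
  shows "coset p \<ominus>\<^bsub>Q\<^esub> coset r = coset (p - r)"
proof -
  interpret Q: ring Q by (rule ring_presented)
  have "coset (p - r) \<oplus>\<^bsub>Q\<^esub> coset r = coset p"
    using assms by (simp add: coset_add diff_in_carrier)
  then show ?thesis
    using assms Q.add.inv_solve_right[of "coset (p - r)" "coset p" "coset r"]
    by (simp add: coset_in_carrier diff_in_carrier a_minus_def a_inv_def)
qed

end

section \<open>Uniqueness and existence of homomorphisms given on generators\<close>

lemma alg_hom_cosets_unique:
  assumes "presentation Gen Rel" "presentation Gen' Rel'"
    and "f \<in> alg_hom (presented_algebra Gen Rel) (presented_algebra Gen' Rel')"
    and "g \<in> alg_hom (presented_algebra Gen Rel) (presented_algebra Gen' Rel')"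
    and eq: "\<And>x. x \<in> Gen \<Longrightarrow> f (coset_of Gen Rel (ncvar x)) = g (coset_of Gen Rel (ncvar x))"
    and "x \<in> carrier (presented_algebra Gen Rel)"
  shows "f x = g x"
proof -
  interpret P: presentation Gen Rel by fact
  interpret P': presentation Gen' Rel' by fact
  interpret Q: ring P.Q by (rule P.ring_presented)
  interpret Q': ring P'.Q by (rule P'.ring_presented)
  have f: "f \<in> ring_hom P.Q P'.Q" and g: "g \<in> ring_hom P.Q P'.Q"
    using assms(3,4) by (auto simp: alg_hom_def)
  have smult: "f (c \<odot>\<^bsub>P.Q\<^esub> y) = c \<odot>\<^bsub>P'.Q\<^esub> f y" "g (c \<odot>\<^bsub>P.Q\<^esub> y) = c \<odot>\<^bsub>P'.Q\<^esub> g y"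
    if "y \<in> carrier P.Q" for c y
    using assms(3,4) that by (auto simp: alg_hom_def)
  have words: "f (P.coset (word w)) = g (P.coset (word w))" if "set w \<subseteq> Gen" for w
    using that
  proof (induction w)
    case Nil
    then show ?case
      using ring_hom_one[OF f] ring_hom_one[OF g] by (simp add: word_Nil P.coset_one)
  next
    case (Cons y w)
    then have "P.coset (word (y # w)) = P.coset (ncvar y) \<otimes>\<^bsub>P.Q\<^esub> P.coset (word w)"
      by (simp add: word_Cons P.coset_mult carrier_intros)
    with Cons show ?case
      by (simp add: ring_hom_mult[OF f] ring_hom_mult[OF g] P.coset_in_carrier carrier_intros eq)
  qed
  obtain p where p: "p \<in> P.C" "x = P.coset p"
    using assms(6) by (auto simp: P.carrier_presented)
  \<comment> \<open>Membership in the carrier is part of the claim because sums of cosets are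
    computed only for representatives in the carrier.\<close>
  have "p \<in> P.C \<and> f (P.coset p) = g (P.coset p)"
    using p(1)
  proof (induction p rule: carrier_induct)
    case zero
    have "f \<zero>\<^bsub>P.Q\<^esub> = \<zero>\<^bsub>P'.Q\<^esub>" "g \<zero>\<^bsub>P.Q\<^esub> = \<zero>\<^bsub>P'.Q\<^esub>"
      by (intro ring_hom_zero f g Q.ring_axioms Q'.ring_axioms)+
    then show ?case by (simp add: P.coset_zero carrier_intros)
  next
    case (add p r)
    then show ?case
      by (simp add: ring_hom_add[OF f] ring_hom_add[OF g] P.coset_in_carrier carrier_intros
          flip: P.coset_add)
  next
    case (word c w)
    then show ?case
      by (simp add: smult words P.coset_in_carrier carrier_intros flip: P.coset_smult)
  qed
  then show ?thesis using p(2) by simp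
qed

text \<open>The elements that substitution sends into the target ideal form an ideal containing the
  relations. The resulting inclusion is exported as well, since the injectivity argument uses it on
  representatives.\<close>

lemma alg_hom_of_subst:
  assumes "presentation Gen Rel" "presentation Gen' Rel'"
    and h: "\<And>x. x \<in> Gen \<Longrightarrow> h x \<in> carrier (free_algebra Gen')"
    and rel: "\<And>l r. (l, r) \<in> Rel \<Longrightarrow> subst h (l - r) \<in> rel_ideal Gen' Rel'"
  obtains f where "f \<in> alg_hom (presented_algebra Gen Rel) (presented_algebra Gen' Rel')"
    and "\<And>p. p \<in> carrier (free_algebra Gen) \<Longrightarrow> f (coset_of Gen Rel p) = coset_of Gen' Rel' (subst h p)"
    and "\<And>p. p \<in> rel_ideal Gen Rel \<Longrightarrow> subst h p \<in> rel_ideal Gen' Rel'"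
proof -
  interpret P: presentation Gen Rel by fact
  interpret P': presentation Gen' Rel' by fact
  have closed: "subst h p \<in> P'.C" if "p \<in> P.C" for p
    using that h by (rule subst_in_carrier)
  have "P.J \<subseteq> {p \<in> P.C. subst h p \<in> P'.J}"
    by (rule P.J_minimal)
      (auto simp: subst_simps closed rel[unfolded subst_linear] P'.J_zero P'.J_add P'.J_mult_left P'.J_mult_right P.J_in_carrier P.rel_in_J
        intro: carrier_intros)
  then have J: "subst h p \<in> P'.J" if "p \<in> P.J" for p
    using that by blast
  \<comment> \<open>A representative is picked by choice; the fact \<open>J\<close> makes the coset
    of its image independent of the pick.\<close>
  define f where "f x = P'.coset (subst h (SOME p. p \<in> P.C \<and> P.coset p = x))" for x
  have f: "f (P.coset p) = P'.coset (subst h p)" if "p \<in> P.C" for p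
  proof -
    define r where "r = (SOME r. r \<in> P.C \<and> P.coset r = P.coset p)"
    have "r \<in> P.C \<and> P.coset r = P.coset p"
      unfolding r_def by (rule someI[of _ p]) (simp add: that)
    then have r: "r \<in> P.C" "r - p \<in> P.J"
      using iffD1[OF P.coset_eq_iff[of r p]] that by blast+
    then have "subst h r - subst h p \<in> P'.J"
      using J[OF r(2)] by (simp add: subst_simps)
    then show ?thesis
      using r(1) that by (simp add: f_def P'.coset_eq_iff closed flip: r_def)
  qed
  have "f \<in> alg_hom P.Q P'.Q"
    unfolding alg_hom_def
    by (auto intro!: ring_hom_memI
        simp: P.carrier_presented P.coset_mult P.coset_add P.coset_one P.coset_smult
          P'.coset_in_carrier P'.coset_mult P'.coset_add P'.coset_one P'.coset_smult
          f closed subst_simps carrier_intros)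
  with f J that show ?thesis by blast
qed

section \<open>The defining relations of the deformed orthogonal algebra hold in the quantum algebra\<close>

definition serre :: "complex \<Rightarrow> 'g ncpoly \<Rightarrow> 'g ncpoly \<Rightarrow> 'g ncpoly" where
  "serre q a b = a * a * b - sc (q + inverse q) (a * b * a) + b * a * a"

text \<open>
  For \<open>a = F\<^sub>i\<close>, \<open>b = F\<^sub>j\<close>, \<open>e = K\<^sub>i\<inverse> E\<^sub>i\<close>, \<open>f = K\<^sub>j\<inverse> E\<^sub>j\<close>, \<open>k = K\<^sub>i\<^sup>-\<^sup>2\<close> with \<open>i\<close>, \<open>j\<close> adjacent,
  \<open>d1\<close> to \<open>d5\<close> vanish in the quantum algebra. The right hand side results from moving \<open>e\<close> and \<open>f\<close>
  to the right in the left hand side.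
\<close>

lemma serre_certificate:
  fixes a b e f k :: "'g ncpoly" and q :: complex
  assumes "q \<noteq> 0" and "q^2 \<noteq> 1"
  defines "r \<equiv> inverse q" and "h \<equiv> 1 / (q - inverse q)"
  defines "d1 \<equiv> e * b - sc r (b * e)" and "d2 \<equiv> e * a - sc (q * q) (a * e) - sc h (1 - k)"
    and "d3 \<equiv> f * a - sc r (a * f)" and "d4 \<equiv> k * b - sc (r * r) (b * k)"
    and "d5 \<equiv> k * f - sc (q * q) (f * k)"
  shows "serre q (a - sc q e) (b - sc q f) + (b - sc q f) =
    serre q a b - sc (q * q * q) (serre q e f)
    - sc q (d3 * a - sc q (a * d3) + sc (1 + q * q) (a * d1) + d2 * b - sc h d4
        - sc (q + r) (d1 * a) - sc (r * r) (b * d2))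
    + sc (q * q) (e * d1 - sc q (d1 * e) - sc (r * r) (d2 * f) + sc (r * r * h) d5
        - sc (q + r) (e * d3) + sc (1 + q * q) (d3 * e) + f * d2)"
proof -
  have qr: "q * r = 1" using assms(1) by (simp add: r_def)
  have "q - r \<noteq> 0"
    using assms(1,2) by (auto simp: r_def field_simps power2_eq_square)
  then have "h * (q - r) = 1"
    unfolding h_def r_def by simp
  then have hq: "h * q = 1 + h * r"
    by (simp add: algebra_simps)
  have "h * (r * r) = (h * q - 1) * r" by (simp add: hq)
  then have hrr: "h * (r * r) = h - r"
    using qr by (simp add: algebra_simps)
  \<comment> \<open>Variants with a trailing factor, so that the three rules also rewrite inside
    longer products of scalars.\<close>
  have ext: "q * (r * x) = x" "h * (q * x) = x + h * (r * x)" "h * (r * (r * x)) = h * x - r * x" for x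
    using qr hq hrr by (metis mult.assoc mult_1, metis mult.assoc distrib_right mult_1, metis mult.assoc left_diff_distrib)
  show ?thesis
    unfolding serre_def d1_def d2_def d3_def d4_def d5_def r_def[symmetric]
    by (simp add: algebra_simps sc_simps sc.scale_left_distrib sc.scale_left_diff_distrib qr hq hrr ext)
qed

text \<open>By the certificate the expression is a combination of two-sided multiples of the
  elements assumed to lie in \<open>J\<close>.\<close>

lemma (in presentation) serre_deformed_in_J:
  fixes q :: complex
  assumes "q \<noteq> 0" and "q^2 \<noteq> 1" and C: "a \<in> C" "b \<in> C" "e \<in> C" "f \<in> C"
    and "e * b - sc (inverse q) (b * e) \<in> J"
    and "e * a - sc (q * q) (a * e) - sc (1 / (q - inverse q)) (1 - k) \<in> J"
    and "f * a - sc (inverse q) (a * f) \<in> J"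
    and "k * b - sc (inverse q * inverse q) (b * k) \<in> J"
    and "k * f - sc (q * q) (f * k) \<in> J"
    and "serre q a b \<in> J" and "serre q e f \<in> J"
  shows "serre q (a - sc q e) (b - sc q f) + (b - sc q f) \<in> J"
  unfolding serre_certificate[OF assms(1,2), of a e b f k]
  by (intro J_add J_diff J_sc assms)
    ((rule J_mult_left, fact, fact | rule J_mult_right, fact, fact)+)?

lemma (in presentation) J_cong_sym: "x - y \<in> J \<Longrightarrow> y - x \<in> J"
  using J_uminus[of "x - y"] by simp

text \<open>Multiply \<open>K * X * L = s X\<close> by \<open>L\<close> from the left, cancel
  \<open>L * K\<close>, and divide by \<open>s\<close>.\<close>

lemma (in presentation) inverse_commutation:
  assumes "K \<in> C" "L \<in> C" "X \<in> C" "L * K - 1 \<in> J" "K * X * L - sc s X \<in> J" "s \<noteq> 0"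
  shows "L * X - sc (inverse s) (X * L) \<in> J"
proof -
  have "L * X - sc (inverse s) (X * L) =
      sc (inverse s) ((L * K - 1) * (X * L) - L * (K * X * L - sc s X))"
    using assms(6) by (simp add: algebra_simps sc_simps)
  moreover have "(L * K - 1) * (X * L) \<in> J" "L * (K * X * L - sc s X) \<in> J"
    using assms by (auto intro: J_mult_left J_mult_right carrier_intros)
  ultimately show ?thesis by (simp only: J_sc J_diff)
qed

lemma (in presentation) inverse_commute:
  assumes "K \<in> C" "L \<in> C" "X \<in> C" "L * K - 1 \<in> J" "K * L - 1 \<in> J" "K * X - X * K \<in> J"
  shows "L * X - X * L \<in> J"
proof -
  have "K * X * L - sc 1 X = (K * X - X * K) * L + X * (K * L - 1)"
    by (simp add: algebra_simps)
  also have "\<dots> \<in> J"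
    using assms by (blast intro: J_add J_mult_left J_mult_right)
  finally show ?thesis
    using inverse_commutation[of K L X 1] assms by simp
qed

section \<open>Relations of the quantum algebra modulo its ideal\<close>

locale quantum_parameter =
  fixes n :: nat and q :: complex
  assumes q_nonzero: "q \<noteq> 0" and q_sq: "q^2 \<noteq> 1"
begin

sublocale so: presentation "so_gens n" "so_rels n q"
  by unfold_locales (rule so_rels_in_carrier)

sublocale sl: presentation "sl_gens n" "sl_rels n q"
  by unfold_locales (rule sl_rels_in_carrier)

lemma gens_in_carrier [simp]:
  assumes "1 \<le> i" "i \<le> n - 1"
  shows "vE i \<in> sl.C" "vF i \<in> sl.C" "vK i \<in> sl.C" "vKinv i \<in> sl.C"
  using assms by (simp_all add: ncvar_in_carrier_iff sl_gens_def)

definition e :: "nat \<Rightarrow> sl_gen ncpoly" where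
  "e i = vKinv i * vE i"

lemma e_in_carrier [simp]: "1 \<le> i \<Longrightarrow> i \<le> n - 1 \<Longrightarrow> e i \<in> sl.C"
  by (simp add: e_def carrier_intros)

context
  fixes i j :: nat
  assumes ij: "1 \<le> i" "i \<le> n - 1" "1 \<le> j" "j \<le> n - 1"
begin

private lemma i: "i \<in> {1..n-1}" and j: "j \<in> {1..n-1}"
  using ij by simp_all

lemma K_Kinv: "vK i * vKinv i - 1 \<in> sl.J"
  by (rule sl.rel_in_J, unfold sl_rels_def Let_def) (use i in blast)

lemma Kinv_K: "vKinv i * vK i - 1 \<in> sl.J"
  by (rule sl.rel_in_J, unfold sl_rels_def Let_def) (use i in blast)

lemma K_K: "vK i * vK j - vK j * vK i \<in> sl.J"
  by (rule sl.rel_in_J, unfold sl_rels_def Let_def) (use i j in blast)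

lemma K_E: "vK i * vE j * vKinv i - sc (q powi cartan i j) (vE j) \<in> sl.J"
  unfolding sc_def by (rule sl.rel_in_J, unfold sl_rels_def Let_def) (use i j in blast)

lemma K_F: "vK i * vF j * vKinv i - sc (q powi (- cartan i j)) (vF j) \<in> sl.J"
  unfolding sc_def by (rule sl.rel_in_J, unfold sl_rels_def Let_def) (use i j in blast)

lemma E_F: "vE i * vF j - vF j * vE i -
    (if i = j then sc (1 / (q - inverse q)) (vK i - vKinv i) else 0) \<in> sl.J"
  unfolding sc_def by (rule sl.rel_in_J, unfold sl_rels_def Let_def) (use i j in blast)

lemma E_E: "\<bar>int i - int j\<bar> > 1 \<Longrightarrow> vE i * vE j - vE j * vE i \<in> sl.J"
  by (rule sl.rel_in_J, unfold sl_rels_def Let_def) (use i j in blast)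

lemma F_F: "\<bar>int i - int j\<bar> > 1 \<Longrightarrow> vF i * vF j - vF j * vF i \<in> sl.J"
  by (rule sl.rel_in_J, unfold sl_rels_def Let_def) (use i j in blast)

lemma serre_E:
  assumes "\<bar>int i - int j\<bar> = 1"
  shows "serre q (vE i) (vE j) \<in> sl.J"
proof -
  have "((vE i)^2 * vE j - ncconst (q + inverse q) * vE i * vE j * vE i + vE j * (vE i)^2, 0) \<in> sl_rels n q"
    using i j assms unfolding sl_rels_def Let_def by blast
  from sl.rel_in_J[OF this] show ?thesis
    by (simp add: serre_def sc_def power2_eq_square mult.assoc)
qed

lemma serre_F:
  assumes "\<bar>int i - int j\<bar> = 1"
  shows "serre q (vF i) (vF j) \<in> sl.J"
proof -
  have "((vF i)^2 * vF j - ncconst (q + inverse q) * vF i * vF j * vF i + vF j * (vF i)^2, 0) \<in> sl_rels n q"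
    using i j assms unfolding sl_rels_def Let_def by blast
  from sl.rel_in_J[OF this] show ?thesis
    by (simp add: serre_def sc_def power2_eq_square mult.assoc)
qed

lemma Kinv_F: "vKinv i * vF j - sc (q powi cartan i j) (vF j * vKinv i) \<in> sl.J"
  using sl.inverse_commutation[OF _ _ _ Kinv_K K_F] ij q_nonzero
  by (simp add: power_int_minus)

lemma Kinv_E: "vKinv i * vE j - sc (q powi (- cartan i j)) (vE j * vKinv i) \<in> sl.J"
  using sl.inverse_commutation[OF _ _ _ Kinv_K K_E] ij q_nonzero
  by (simp add: power_int_minus)

lemma E_Kinv: "vE j * vKinv i - sc (q powi cartan i j) (vKinv i * vE j) \<in> sl.J"
proof -
  have "vE j * vKinv i - sc (q powi cartan i j) (vKinv i * vE j) =
      sc (- (q powi cartan i j)) (vKinv i * vE j - sc (q powi (- cartan i j)) (vE j * vKinv i))"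
    using q_nonzero by (simp add: algebra_simps sc_simps power_int_minus)
  then show ?thesis by (simp only: sl.J_sc[OF Kinv_E])
qed

end

context
  fixes i j :: nat
  assumes ij: "1 \<le> i" "i \<le> n - 1" "1 \<le> j" "j \<le> n - 1"
begin

lemma Kinv_Kinv: "vKinv i * vKinv j - vKinv j * vKinv i \<in> sl.J"
proof -
  have "vKinv i * vK j - vK j * vKinv i \<in> sl.J"
    using sl.inverse_commute[of "vK i" "vKinv i" "vK j"] ij by (simp add: Kinv_K K_Kinv K_K)
  then have "vKinv j * vKinv i - vKinv i * vKinv j \<in> sl.J"
    using sl.inverse_commute[of "vK j" "vKinv j" "vKinv i"] ij sl.J_cong_sym
    by (simp add: Kinv_K K_Kinv)
  then show ?thesis by (rule sl.J_cong_sym)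
qed

text \<open>Multiply the commutator of \<open>vE i\<close> and \<open>vF j\<close> by
  \<open>vKinv i\<close> and move that factor past \<open>vF j\<close>. The diagonal case supplies
  \<open>d2\<close> of the certificate with \<open>k\<close> the square of \<open>vKinv i\<close>,
  the adjacent cases supply \<open>d1\<close> and \<open>d3\<close>.\<close>

lemma e_F: "e i * vF j - sc (q powi cartan i j) (vF j * e i) -
    (if i = j then sc (1 / (q - inverse q)) (1 - vKinv i * vKinv i) else 0) \<in> sl.J"
proof -
  let ?h = "1 / (q - inverse q)"
  have "e i * vF j - sc (q powi cartan i j) (vF j * e i) -
      (if i = j then sc ?h (1 - vKinv i * vKinv i) else 0) =
    vKinv i * (vE i * vF j - vF j * vE i - (if i = j then sc ?h (vK i - vKinv i) else 0))
    + (vKinv i * vF j - sc (q powi cartan i j) (vF j * vKinv i)) * vE i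
    + (if i = j then sc ?h (vKinv i * vK i - 1) else 0)"
    by (simp add: e_def algebra_simps sc_simps)
  moreover have "vKinv i * (vE i * vF j - vF j * vE i - (if i = j then sc ?h (vK i - vKinv i) else 0)) \<in> sl.J"
    using ij E_F by (intro sl.J_mult_left) simp_all
  moreover have "(vKinv i * vF j - sc (q powi cartan i j) (vF j * vKinv i)) * vE i \<in> sl.J"
    using ij Kinv_F by (intro sl.J_mult_right) simp_all
  moreover have "(if i = j then sc ?h (vKinv i * vK i - 1) else 0) \<in> sl.J"
    using ij by (simp add: sl.J_sc Kinv_K sl.J_zero)
  ultimately show ?thesis by (simp only: sl.J_add)
qed

lemma Kinv_e: "vKinv i * e j - sc (q powi (- cartan i j)) (e j * vKinv i) \<in> sl.J"
proof -
  have "vKinv i * e j - sc (q powi (- cartan i j)) (e j * vKinv i) =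
    (vKinv i * vKinv j - vKinv j * vKinv i) * vE j
    + vKinv j * (vKinv i * vE j - sc (q powi (- cartan i j)) (vE j * vKinv i))"
    by (simp add: e_def algebra_simps sc_simps)
  also have "\<dots> \<in> sl.J"
    using ij by (intro sl.J_add sl.J_mult_right Kinv_Kinv sl.J_mult_left[of "vKinv j"] Kinv_E) simp_all
  finally show ?thesis .
qed

lemma e_e: "e i * e j - sc (q powi cartan j i) (vKinv i * vKinv j * (vE i * vE j)) \<in> sl.J"
proof -
  have "e i * e j - sc (q powi cartan j i) (vKinv i * vKinv j * (vE i * vE j)) =
    vKinv i * ((vE i * vKinv j - sc (q powi cartan j i) (vKinv j * vE i)) * vE j)"
    by (simp add: e_def algebra_simps sc_simps)
  also have "\<dots> \<in> sl.J"
    using ij by (intro sl.J_mult_left[of "vKinv i"] sl.J_mult_right E_Kinv) simp_all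
  finally show ?thesis .
qed

text \<open>Each crossing of a \<open>vE\<close> with a \<open>vKinv\<close> further to the right
  adds one Cartan integer to the exponent; three crossings bring all \<open>vKinv\<close> to the
  front.\<close>

lemma e_e_e:
  assumes "1 \<le> k" "k \<le> n - 1"
  shows "e i * e j * e k - sc (q powi (cartan k j + cartan j i + cartan k i))
    (vKinv i * vKinv j * vKinv k * (vE i * vE j * vE k)) \<in> sl.J"
proof -
  let ?x = "q powi cartan k j" and ?y = "q powi cartan j i" and ?z = "q powi cartan k i"
  have "e i * e j * e k - sc (q powi (cartan k j + cartan j i + cartan k i))
      (vKinv i * vKinv j * vKinv k * (vE i * vE j * vE k)) =
    vKinv i * vE i * vKinv j * ((vE j * vKinv k - sc ?x (vKinv k * vE j)) * vE k)
    + sc ?x (vKinv i * ((vE i * vKinv j - sc ?y (vKinv j * vE i)) * (vKinv k * vE j * vE k)))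
    + sc (?x * ?y) (vKinv i * vKinv j * ((vE i * vKinv k - sc ?z (vKinv k * vE i)) * (vE j * vE k)))"
    using q_nonzero by (simp add: e_def algebra_simps sc_simps power_int_add)
  also have "\<dots> \<in> sl.J"
    using ij assms
    by (intro sl.J_add sl.J_sc sl.J_mult_left[of "vKinv i * vE i * vKinv j"]
        sl.J_mult_left[of "vKinv i"] sl.J_mult_left[of "vKinv i * vKinv j"] sl.J_mult_right E_Kinv
        mult_in_carrier) simp_all
  finally show ?thesis .
qed

end

section \<open>The images of the generators and their relations\<close>

definition B :: "nat \<Rightarrow> sl_gen ncpoly" where
  "B i = vF i - sc q (e i)"

lemma B_in_carrier: "1 \<le> i \<Longrightarrow> i \<le> n - 1 \<Longrightarrow> B i \<in> sl.C"
  by (simp add: B_def carrier_intros)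

text \<open>For each of the three words the exponent in \<open>e_e_e\<close> is -1 - 1 + 2 = 0. Once
  the \<open>vKinv\<close> are put in one order, they factor out of the \<open>q\<close>-Serre
  relation for the \<open>vE\<close>.\<close>

lemma serre_e:
  assumes ij: "1 \<le> i" "i \<le> n - 1" "1 \<le> j" "j \<le> n - 1" and "\<bar>int i - int j\<bar> = 1"
  shows "serre q (e i) (e j) \<in> sl.J"
proof -
  let ?L = "\<lambda>i. vKinv i :: sl_gen ncpoly" and ?E = "\<lambda>i. vE i :: sl_gen ncpoly"
  have c: "cartan i j = - 1" "cartan j i = - 1" "cartan i i = 2" "cartan j j = 2"
    using assms(5) by (auto simp: cartan_def)
  have iij: "e i * e i * e j - ?L i * ?L i * ?L j * (?E i * ?E i * ?E j) \<in> sl.J"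
    using e_e_e[of i i j] ij by (simp add: c)
  have iji: "e i * e j * e i - ?L i * ?L j * ?L i * (?E i * ?E j * ?E i) \<in> sl.J"
    using e_e_e[of i j i] ij by (simp add: c)
  have jii: "e j * e i * e i - ?L j * ?L i * ?L i * (?E j * ?E i * ?E i) \<in> sl.J"
    using e_e_e[of j i i] ij by (simp add: c)
  have comm: "?L j * ?L i - ?L i * ?L j \<in> sl.J"
    using ij by (intro Kinv_Kinv)
  have "serre q (e i) (e j) =
    (e i * e i * e j - ?L i * ?L i * ?L j * (?E i * ?E i * ?E j))
    - sc (q + inverse q) ((e i * e j * e i - ?L i * ?L j * ?L i * (?E i * ?E j * ?E i))
        + ?L i * ((?L j * ?L i - ?L i * ?L j) * (?E i * ?E j * ?E i)))
    + ((e j * e i * e i - ?L j * ?L i * ?L i * (?E j * ?E i * ?E i))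
        + ((?L j * ?L i - ?L i * ?L j) * (?L i * (?E j * ?E i * ?E i))
          + ?L i * ((?L j * ?L i - ?L i * ?L j) * (?E j * ?E i * ?E i))))
    + ?L i * ?L i * ?L j * serre q (?E i) (?E j)"
    by (simp add: serre_def algebra_simps sc_simps)
  also have "\<dots> \<in> sl.J"
    by (rule iij iji jii comm serre_E |
        rule sl.J_mult_left[of "?L i"] sl.J_mult_left[of "?L i * ?L i * ?L j"] |
        rule sl.J_add sl.J_diff sl.J_sc sl.J_mult_right mult_in_carrier gens_in_carrier | fact)+
  finally show ?thesis .
qed

text \<open>The pure parts vanish by the Serre relations for \<open>vF\<close> and \<open>e\<close>,
  and the mixed products leave exactly \<open>- B j\<close>. Since \<open>i\<close> and
  \<open>j\<close> may be adjacent in either order, this covers both cubic families of the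
  orthogonal algebra.\<close>

lemma serre_B:
  assumes ij: "1 \<le> i" "i \<le> n - 1" "1 \<le> j" "j \<le> n - 1" and "\<bar>int i - int j\<bar> = 1"
  shows "serre q (B i) (B j) + B j \<in> sl.J"
proof -
  have c: "cartan i j = - 1" "cartan j i = - 1" "cartan i i = 2" "cartan j j = 2" "i \<noteq> j"
    using assms(5) by (auto simp: cartan_def)
  have LF: "vKinv i * vF j - sc (inverse q) (vF j * vKinv i) \<in> sl.J"
    using Kinv_F[of i j] ij by (simp add: c power_int_minus)
  have Le: "vKinv i * e j - sc q (e j * vKinv i) \<in> sl.J"
    using Kinv_e[of i j] ij by (simp add: c)
  show ?thesis
    unfolding B_def
  proof (rule sl.serre_deformed_in_J[OF q_nonzero q_sq, where k = "vKinv i * vKinv i"])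
    show "vF i \<in> sl.C" "vF j \<in> sl.C" "e i \<in> sl.C" "e j \<in> sl.C"
      using ij by simp_all
    show "e i * vF j - sc (inverse q) (vF j * e i) \<in> sl.J"
      using e_F[of i j] ij by (simp add: c power_int_minus)
    show "e i * vF i - sc (q * q) (vF i * e i) - sc (1 / (q - inverse q)) (1 - vKinv i * vKinv i) \<in> sl.J"
      using e_F[of i i] ij by (simp add: c power2_eq_square)
    show "e j * vF i - sc (inverse q) (vF i * e j) \<in> sl.J"
      using e_F[of j i] ij c(5) by (simp add: c power_int_minus)
    \<comment> \<open>The square of \<open>vKinv i\<close> passes \<open>vF j\<close> in two single
      crossings, each with factor \<open>inverse q\<close>.\<close>
    have "vKinv i * vKinv i * vF j - sc (inverse q * inverse q) (vF j * (vKinv i * vKinv i)) =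
        vKinv i * (vKinv i * vF j - sc (inverse q) (vF j * vKinv i))
        + sc (inverse q) ((vKinv i * vF j - sc (inverse q) (vF j * vKinv i)) * vKinv i)"
      by (simp add: algebra_simps sc_simps)
    also have "\<dots> \<in> sl.J"
      using ij LF by (intro sl.J_add sl.J_sc sl.J_mult_left[of "vKinv i"] sl.J_mult_right[of "vKinv i"]) simp_all
    finally show "vKinv i * vKinv i * vF j - sc (inverse q * inverse q) (vF j * (vKinv i * vKinv i)) \<in> sl.J" .
    have "vKinv i * vKinv i * e j - sc (q * q) (e j * (vKinv i * vKinv i)) =
        vKinv i * (vKinv i * e j - sc q (e j * vKinv i))
        + sc q ((vKinv i * e j - sc q (e j * vKinv i)) * vKinv i)"
      by (simp add: algebra_simps sc_simps)
    also have "\<dots> \<in> sl.J"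
      using ij Le by (intro sl.J_add sl.J_sc sl.J_mult_left[of "vKinv i"] sl.J_mult_right[of "vKinv i"]) simp_all
    finally show "vKinv i * vKinv i * e j - sc (q * q) (e j * (vKinv i * vKinv i)) \<in> sl.J" .
    show "serre q (vF i) (vF j) \<in> sl.J" "serre q (e i) (e j) \<in> sl.J"
      using assms by (simp_all add: serre_F serre_e)
  qed
qed

text \<open>For distant nodes the Cartan integers are 0, so the \<open>vF\<close>, the mixed and the
  \<open>e\<close> products commute separately.\<close>

lemma B_commute:
  assumes ij: "1 \<le> i" "i \<le> n - 1" "1 \<le> j" "j \<le> n - 1" and far: "\<bar>int i - int j\<bar> > 1"
  shows "B i * B j - B j * B i \<in> sl.J"
proof -
  have c: "cartan i j = 0" "cartan j i = 0" "i \<noteq> j" "j \<noteq> i"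
    using far by (auto simp: cartan_def)
  have far': "\<bar>int j - int i\<bar> > 1" using far by simp
  have eF: "e i * vF j - vF j * e i \<in> sl.J" "e j * vF i - vF i * e j \<in> sl.J"
    using e_F[of i j] e_F[of j i] ij c(3,4) by (simp_all add: c)
  have ee: "e i * e j - vKinv i * vKinv j * (vE i * vE j) \<in> sl.J"
    "e j * e i - vKinv j * vKinv i * (vE j * vE i) \<in> sl.J"
    using e_e[of i j] e_e[of j i] ij by (simp_all add: c)
  have "e i * e j - e j * e i = (e i * e j - vKinv i * vKinv j * (vE i * vE j))
      - (e j * e i - vKinv j * vKinv i * (vE j * vE i))
      + ((vKinv i * vKinv j - vKinv j * vKinv i) * (vE i * vE j)
        + vKinv j * vKinv i * (vE i * vE j - vE j * vE i))"
    by (simp add: algebra_simps)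
  also have "\<dots> \<in> sl.J"
    by (rule ee Kinv_Kinv E_E | rule sl.J_mult_left[of "vKinv j * vKinv i"] |
        rule sl.J_add sl.J_diff sl.J_mult_right mult_in_carrier gens_in_carrier | fact)+
  finally have e: "e i * e j - e j * e i \<in> sl.J" .
  have "B i * B j - B j * B i = (vF i * vF j - vF j * vF i) + sc q (e j * vF i - vF i * e j)
      - sc q (e i * vF j - vF j * e i) + sc (q * q) (e i * e j - e j * e i)"
    by (simp add: B_def algebra_simps sc_simps)
  also have "\<dots> \<in> sl.J"
    by (rule eF e F_F | rule sl.J_add sl.J_diff sl.J_sc | fact)+
  finally show ?thesis .
qed

text \<open>The desired homomorphism on letters, at the level of representatives. On
  \<open>so_gens n\<close> the second index determines the letter.\<close>

definition \<beta> :: "so_gen \<Rightarrow> sl_gen ncpoly" where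
  "\<beta> g = (case g of gen_I a b \<Rightarrow> B b)"

lemma \<beta>_in_carrier: "g \<in> so_gens n \<Longrightarrow> \<beta> g \<in> sl.C"
  by (auto simp: \<beta>_def so_gens_def B_in_carrier)

lemma subst_so_rels:
  assumes "(l, r) \<in> so_rels n q"
  shows "subst \<beta> (l - r) \<in> sl.J"
proof -
  consider
    (1) i where "2 \<le> i" "i \<le> n - 1" "l = (vI i (i-1))^2 * vI (i+1) i
         - ncconst (q + inverse q) * vI i (i-1) * vI (i+1) i * vI i (i-1) + vI (i+1) i * (vI i (i-1))^2"
      "r = - vI (i+1) i"
  | (2) i where "2 \<le> i" "i \<le> n - 1" "l = vI i (i-1) * (vI (i+1) i)^2
         - ncconst (q + inverse q) * vI (i+1) i * vI i (i-1) * vI (i+1) i + (vI (i+1) i)^2 * vI i (i-1)"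
      "r = - vI i (i-1)"
  | (3) i j where "2 \<le> i" "i \<le> n" "2 \<le> j" "j \<le> n" "\<bar>int i - int j\<bar> > 1"
      "l = vI i (i-1) * vI j (j-1) - vI j (j-1) * vI i (i-1)" "r = 0"
    using assms unfolding so_rels_def by fastforce
  then show ?thesis
  proof cases
    case 1
    \<comment> \<open>The letter \<open>gen_I i (i - 1)\<close> goes to \<open>B (i - 1)\<close>,
      hence the shift of the index.\<close>
    have "subst \<beta> (l - r) = serre q (B (i - 1)) (B i) + B i"
      unfolding 1(3,4) serre_def ncconst_eq_sc
      by (simp add: subst_simps \<beta>_def power2_eq_square sc_simps algebra_simps)
    also have "\<dots> \<in> sl.J" using 1(1,2) by (intro serre_B) auto
    finally show ?thesis .
  next
    case 2
    have "subst \<beta> (l - r) = serre q (B i) (B (i - 1)) + B (i - 1)"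
      unfolding 2(3,4) serre_def ncconst_eq_sc
      by (simp add: subst_simps \<beta>_def power2_eq_square sc_simps algebra_simps)
    also have "\<dots> \<in> sl.J" using 2(1,2) by (intro serre_B) auto
    finally show ?thesis .
  next
    case 3
    have "subst \<beta> (l - r) = B (i - 1) * B (j - 1) - B (j - 1) * B (i - 1)"
      unfolding 3(6,7) by (simp add: subst_simps \<beta>_def)
    also have "\<dots> \<in> sl.J" using 3(1-5) by (intro B_commute) auto
    finally show ?thesis .
  qed
qed

end

section \<open>A highest weight module on the free algebra\<close>

fun row :: "so_gen \<Rightarrow> nat" where
  "row (gen_I a b) = b"

definition weight :: "nat \<Rightarrow> so_gen list \<Rightarrow> int" where
  "weight i w = (\<Sum>g\<leftarrow>w. cartan i (row g))"

text \<open>A word has as weight minus the sum of the simple roots of its letters. The free base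
  \<open>p\<close> yields the operator of \<open>vK i\<close> for \<open>p = q\<close> and of
  \<open>vKinv i\<close> for \<open>p = inverse q\<close>.\<close>

definition opK :: "complex \<Rightarrow> nat \<Rightarrow> so_gen ncpoly \<Rightarrow> so_gen ncpoly" where
  "opK p i = lin (\<lambda>w. sc (p powi (- weight i w)) (word w))"

text \<open>The value prescribed for the commutator of \<open>vE i\<close> and
  \<open>vF i\<close>.\<close>

definition opH :: "complex \<Rightarrow> nat \<Rightarrow> so_gen ncpoly \<Rightarrow> so_gen ncpoly" where
  "opH q i m = sc (1 / (q - inverse q)) (opK q i m - opK (inverse q) i m)"

text \<open>Forced by two demands: the highest weight vector is killed, and passing a letter leaves
  the commutator, which is an \<open>opH\<close> term at the letter of \<open>vF i\<close> and 0 at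
  all others.\<close>

fun Eword :: "complex \<Rightarrow> nat \<Rightarrow> so_gen list \<Rightarrow> so_gen ncpoly" where
  "Eword q i [] = 0"
| "Eword q i (g # w) = ncvar g * Eword q i w + (if g = gen_I (i + 1) i then opH q i (word w) else 0)"

definition opE :: "complex \<Rightarrow> nat \<Rightarrow> so_gen ncpoly \<Rightarrow> so_gen ncpoly" where
  "opE q i = lin (Eword q i)"

lemma linop_opK: "linop (opK p i)"
  unfolding opK_def by (rule linop_lin)

lemma linop_opE: "linop (opE q i)"
  unfolding opE_def by (rule linop_lin)

lemma linop_opH: "linop (opH q i)"
  unfolding opH_def[abs_def] by (intro linop_sc linop_diff linop_opK)

lemmas linop_op_intros = linop_intros linop_compose[OF linop_opK] linop_compose[OF linop_opE]

lemmas op_linear =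
  module_hom.add[OF linop_opK] module_hom.scale[OF linop_opK] module_hom.diff[OF linop_opK]
  module_hom.neg[OF linop_opK] module_hom.zero[OF linop_opK]
  module_hom.add[OF linop_opE] module_hom.scale[OF linop_opE] module_hom.diff[OF linop_opE]
  module_hom.neg[OF linop_opE] module_hom.zero[OF linop_opE]

lemma opK_word: "opK p i (word w) = sc (p powi (- weight i w)) (word w)"
  by (simp add: opK_def lin_word)

lemma opK_one: "opK p i 1 = 1"
  using opK_word[of p i "[]"] by (simp add: weight_def word_Nil)

lemma opE_one: "opE q i 1 = 0"
  using lin_word[of "Eword q i" "[]"] by (simp add: opE_def word_Nil)

lemma opK_word_mult:
  assumes "p \<noteq> 0"
  shows "opK p i (word u * m) = sc (p powi (- weight i u)) (word u * opK p i m)"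
proof (rule linop_ext[of "\<lambda>m. opK p i (word u * m)"])
  show "linop (\<lambda>m. opK p i (word u * m))"
    by (intro linop_op_intros)
  show "linop (\<lambda>m. sc (p powi (- weight i u)) (word u * opK p i m))"
    by (intro linop_op_intros)
  fix w
  have "- weight i (u @ w) = - weight i u + - weight i w"
    by (simp add: weight_def)
  then have "p powi (- weight i (u @ w)) = p powi (- weight i u) * p powi (- weight i w)"
    using assms by (simp only: power_int_add simp_thms)
  then show "opK p i (word u * word w) = sc (p powi (- weight i u)) (word u * opK p i (word w))"
    by (simp add: opK_word sc_simps flip: word_append)
qed

lemma opK_ncvar_mult:
  "p \<noteq> 0 \<Longrightarrow> opK p i (ncvar g * m) = sc (p powi (- cartan i (row g))) (ncvar g * opK p i m)"
  using opK_word_mult[of p i "[g]" m] by (simp add: ncvar_eq_word weight_def)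

lemma opK_commute: "opK p i (opK p' j m) = opK p' j (opK p i m)"
  by (rule linop_ext[of "\<lambda>m. opK p i (opK p' j m)"])
    (intro linop_op_intros | simp add: opK_word op_linear mult.commute)+

lemma opK_inverse:
  assumes "p \<noteq> 0"
  shows "opK p i (opK (inverse p) i m) = m"
  by (rule linop_ext[of "\<lambda>m. opK p i (opK (inverse p) i m)"])
    (intro linop_op_intros | use assms in \<open>simp add: opK_word op_linear power_int_inverse\<close>)+

lemma opE_ncvar_mult:
  "opE q i (ncvar g * m) = ncvar g * opE q i m + (if g = gen_I (i + 1) i then opH q i m else 0)"
proof (rule linop_ext[of "\<lambda>m. opE q i (ncvar g * m)"])
  show "linop (\<lambda>m. opE q i (ncvar g * m))"
    by (intro linop_op_intros)
  show "linop (\<lambda>m. ncvar g * opE q i m + (if g = gen_I (i + 1) i then opH q i m else 0))"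
    by (cases "g = gen_I (i + 1) i") (simp_all add: linop_intros linop_opE linop_opH)
  show "opE q i (ncvar g * word w) =
      ncvar g * opE q i (word w) + (if g = gen_I (i + 1) i then opH q i (word w) else 0)" for w
    by (simp add: opE_def lin_word flip: word_Cons)
qed

text \<open>The induction suited to these operators, which are known at 1 and by how they pass a
  letter.\<close>

lemma linop_ext_ncvar:
  assumes "linop f" "linop g" "f 1 = g 1" and "\<And>x m. f m = g m \<Longrightarrow> f (ncvar x * m) = g (ncvar x * m)"
  shows "f m = g m"
proof (rule linop_ext[OF assms(1,2)])
  show "f (word w) = g (word w)" for w
    by (induction w) (simp_all add: word_Nil word_Cons assms(3,4))
qed

text \<open>\<open>opE q j\<close> deletes one letter of row \<open>j\<close>, which changes the
  exponent in \<open>opK p i\<close> by \<open>cartan i j\<close>.\<close>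

lemma opK_opE:
  assumes "p \<noteq> 0" "q \<noteq> 0"
  shows "opK p i (opE q j m) = sc (p powi cartan i j) (opE q j (opK p i m))"
proof (rule linop_ext_ncvar[of "\<lambda>m. opK p i (opE q j m)"])
  show "linop (\<lambda>m. opK p i (opE q j m))"
    by (intro linop_op_intros)
  show "linop (\<lambda>m. sc (p powi cartan i j) (opE q j (opK p i m)))"
    by (intro linop_op_intros)
  show "opK p i (opE q j 1) = sc (p powi cartan i j) (opE q j (opK p i 1))"
    by (simp add: opE_one opK_one op_linear)
next
  fix g m assume "opK p i (opE q j m) = sc (p powi cartan i j) (opE q j (opK p i m))"
  then show "opK p i (opE q j (ncvar g * m)) = sc (p powi cartan i j) (opE q j (opK p i (ncvar g * m)))"
    using assms
    by (auto simp: opE_ncvar_mult opK_ncvar_mult op_linear sc_simps opH_def power_int_minus mult.commute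
      opK_commute[of p i])
qed

lemma opE_commute:
  assumes "q \<noteq> 0" and far: "\<bar>int i - int j\<bar> > 1"
  shows "opE q i (opE q j m) = opE q j (opE q i m)"
proof (rule linop_ext_ncvar[of "\<lambda>m. opE q i (opE q j m)"])
  have c: "cartan i j = 0" "cartan j i = 0" "i \<noteq> j" "j \<noteq> i"
    using far by (auto simp: cartan_def)
  fix g m assume "opE q i (opE q j m) = opE q j (opE q i m)"
  then show "opE q i (opE q j (ncvar g * m)) = opE q j (opE q i (ncvar g * m))"
    using assms(1) by (auto simp: opE_ncvar_mult op_linear opH_def opK_opE c)
qed (intro linop_op_intros | simp add: opE_one op_linear)+

lemma opE_serre:
  assumes q: "q \<noteq> 0" and near: "\<bar>int i - int j\<bar> = 1"
  shows "opE q i (opE q i (opE q j m)) - sc (q + inverse q) (opE q i (opE q j (opE q i m)))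
    + opE q j (opE q i (opE q i m)) = 0"
proof (rule linop_ext_ncvar[of "\<lambda>m. opE q i (opE q i (opE q j m))
    - sc (q + inverse q) (opE q i (opE q j (opE q i m))) + opE q j (opE q i (opE q i m))" "\<lambda>_. 0"])
  let ?u = "\<lambda>m. opE q i (opE q i (opE q j m))
    - sc (q + inverse q) (opE q i (opE q j (opE q i m))) + opE q j (opE q i (opE q i m))"
  define r where "r = inverse q"
  define h where "h = 1 / (q - r)"
  have qr: "q * r = 1" "q * (r * x) = x" for x using q by (simp_all add: r_def)
  have inv: "inverse q = r" "inverse r = q" "r \<noteq> 0" using q by (simp_all add: r_def)
  have c: "cartan i j = - 1" "cartan j i = - 1" "cartan i i = 2" "cartan j j = 2" "i \<noteq> j"
    using near by (auto simp: cartan_def)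
  have H: "opH q k m = sc h (opK q k m - opK r k m)" for k m
    by (simp add: opH_def h_def inv)
  fix g m assume "?u m = 0"
  \<comment> \<open>The \<open>opH\<close> terms that arise on passing a letter cancel, so the Serre
    combination commutes with letters; as it kills 1, it vanishes.\<close>
  moreover have "?u (ncvar g * m) = ncvar g * ?u m"
    using q inv(3) c(5)
    by (auto simp: opE_ncvar_mult op_linear H opK_opE c power_int_minus inv power2_eq_square
      algebra_simps sc_simps sc.scale_left_distrib qr)
  ultimately show "?u (ncvar g * m) = 0" by simp
qed (intro linop_op_intros | simp add: opE_one op_linear)+

text \<open>All \<open>opH\<close> terms cancel: Serre elements are singular vectors, which is why
  the ideal they generate is stable under \<open>opE\<close>.\<close>

lemma opE_serre_mult:
  fixes i j :: nat
  assumes q: "q \<noteq> 0" and near: "\<bar>int i - int j\<bar> = 1"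
  shows "opE q k (serre q (vI (i + 1) i) (vI (j + 1) j) * m) =
    serre q (vI (i + 1) i) (vI (j + 1) j) * opE q k m"
proof -
  define r where "r = inverse q"
  define h where "h = 1 / (q - r)"
  have qr: "q * r = 1" "q * (r * x) = x" for x using q by (simp_all add: r_def)
  have inv: "inverse q = r" "inverse r = q" "r \<noteq> 0" using q by (simp_all add: r_def)
  have c: "cartan i j = - 1" "cartan j i = - 1" "cartan i i = 2" "cartan j j = 2" "i \<noteq> j"
    using near by (auto simp: cartan_def)
  have H: "opH q k m = sc h (opK q k m - opK r k m)" for k m
    by (simp add: opH_def h_def inv)
  show ?thesis
    using q inv(3) unfolding serre_def
    by (cases "k = i"; cases "k = j") (simp_all add: c(5)[symmetric] opE_ncvar_mult opK_ncvar_mult op_linear H c power_int_minus inv power2_eq_square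
      algebra_simps sc_simps sc.scale_left_distrib qr)
qed

lemma opE_commutator_mult:
  fixes i j :: nat
  assumes q: "q \<noteq> 0" and far: "\<bar>int i - int j\<bar> > 1"
  shows "opE q k ((vI (i + 1) i * vI (j + 1) j - vI (j + 1) j * vI (i + 1) i) * m) =
    (vI (i + 1) i * vI (j + 1) j - vI (j + 1) j * vI (i + 1) i) * opE q k m"
proof -
  have c: "cartan i j = 0" "cartan j i = 0" "i \<noteq> j" "j \<noteq> i"
    using far by (auto simp: cartan_def)
  show ?thesis
    using q c(3,4)
    by (cases "k = i"; cases "k = j") (simp_all add: opE_ncvar_mult opK_ncvar_mult op_linear opH_def c algebra_simps sc_simps)
qed

section \<open>The ideal of Serre elements as a submodule\<close>

context quantum_parameter
begin

definition serre_elements :: "so_gen ncpoly set" where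
  "serre_elements =
    {serre q (vI (i + 1) i) (vI (j + 1) j) | i j.
      i \<in> {1..n-1} \<and> j \<in> {1..n-1} \<and> \<bar>int i - int j\<bar> = 1} \<union>
    {vI (i + 1) i * vI (j + 1) j - vI (j + 1) j * vI (i + 1) i | i j.
      i \<in> {1..n-1} \<and> j \<in> {1..n-1} \<and> \<bar>int i - int j\<bar> > 1}"

text \<open>The two-sided ideal of \<open>so.C\<close> generated by the Serre elements, presented as
  a span so that induction meets only homogeneous generators.\<close>

inductive_set S :: "so_gen ncpoly set" where
  S_zero: "0 \<in> S"
| S_add: "x \<in> S \<Longrightarrow> y \<in> S \<Longrightarrow> x + y \<in> S"
| S_word: "set u \<subseteq> so_gens n \<Longrightarrow> set v \<subseteq> so_gens n \<Longrightarrow> s \<in> serre_elements \<Longrightarrow>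
    sc c (word u * s * word v) \<in> S"

lemma so_gen_in_carrier: "1 \<le> i \<Longrightarrow> i \<le> n - 1 \<Longrightarrow> vI (Suc i) i \<in> so.C"
  by (auto simp: ncvar_in_carrier_iff so_gens_def)

lemma S_sc: "x \<in> S \<Longrightarrow> sc c x \<in> S"
  by (induction rule: S.induct) (auto simp: sc_simps intro: S.intros)

lemma S_diff: "x \<in> S \<Longrightarrow> y \<in> S \<Longrightarrow> x - y \<in> S"
  using S_add[of x "- y"] S_sc[of y "- 1"] by simp

lemma S_word_mult: "x \<in> S \<Longrightarrow> set u \<subseteq> so_gens n \<Longrightarrow> word u * x \<in> S"
proof (induction rule: S.induct)
  case (S_word v w s c)
  have "word u * sc c (word v * s * word w) = sc c (word (u @ v) * s * word w)"
    by (simp add: word_append sc_simps mult.assoc)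
  then show ?case using S_word by (simp only:) (rule S.S_word; simp)
qed (simp_all add: distrib_left S.intros)

lemma S_mult_word: "x \<in> S \<Longrightarrow> set u \<subseteq> so_gens n \<Longrightarrow> x * word u \<in> S"
proof (induction rule: S.induct)
  case (S_word v w s c)
  have "sc c (word v * s * word w) * word u = sc c (word v * s * word (w @ u))"
    by (simp add: word_append sc_simps mult.assoc)
  then show ?case using S_word by (simp only:) (rule S.S_word; simp)
qed (simp_all add: distrib_right S.intros)

lemma S_mult_left: "a \<in> so.C \<Longrightarrow> x \<in> S \<Longrightarrow> a * x \<in> S"
  by (induction a rule: carrier_induct) (auto simp: distrib_right sc_simps S_word_mult intro: S.intros S_sc)

lemma S_mult_right: "a \<in> so.C \<Longrightarrow> x \<in> S \<Longrightarrow> x * a \<in> S"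
  by (induction a rule: carrier_induct) (auto simp: distrib_left sc_simps S_mult_word intro: S.intros S_sc)

lemma serre_in_S: "s \<in> serre_elements \<Longrightarrow> s \<in> S"
  using S_word[of "[]" "[]" s 1] by (simp add: word_Nil)

text \<open>All words of a Serre element have the same letters up to order, so it is a weight
  vector.\<close>

lemma opK_serre_elements:
  assumes "s \<in> serre_elements" "p \<noteq> 0"
  obtains t where "\<And>m. opK p i (s * m) = sc t (s * opK p i m)"
proof -
  consider a b where "s = serre q (vI (Suc a) a) (vI (Suc b) b)"
    | a b where "s = vI (Suc a) a * vI (Suc b) b - vI (Suc b) b * vI (Suc a) a"
    using assms(1) by (auto simp: serre_elements_def)
  then show ?thesis
  proof cases
    case 1
    show ?thesis
      by (rule that[of "p powi (- cartan i a) * (p powi (- cartan i a) * p powi (- cartan i b))"])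
        (simp add: 1 serre_def opK_ncvar_mult assms(2) op_linear sc_simps algebra_simps)
  next
    case 2
    show ?thesis
      by (rule that[of "p powi (- cartan i a) * p powi (- cartan i b)"])
        (simp add: 2 opK_ncvar_mult assms(2) op_linear sc_simps algebra_simps)
  qed
qed

lemma opK_in_carrier:
  assumes "x \<in> so.C"
  shows "opK p i x \<in> so.C"
  using assms
  by (induction x rule: carrier_induct) (simp_all add: op_linear opK_word carrier_intros)

lemma opK_in_S:
  assumes "x \<in> S" "p \<noteq> 0"
  shows "opK p i x \<in> S"
  using assms(1)
proof (induction rule: S.induct)
  case (S_word u v s c)
  obtain t where "\<And>m. opK p i (s * m) = sc t (s * opK p i m)"
    using opK_serre_elements[OF S_word(3) assms(2)] by blast
  then have "opK p i (sc c (word u * s * word v)) =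
      sc (c * p powi (- weight i u) * t * p powi (- weight i v)) (word u * s * word v)"
    by (simp add: op_linear opK_word_mult assms(2) opK_word sc_simps mult.assoc)
  then show ?case using S_word by (simp add: S.S_word)
qed (simp_all add: op_linear S.intros)

lemma opH_in_S: "x \<in> S \<Longrightarrow> opH q i x \<in> S"
  by (simp add: opH_def S_sc S_diff opK_in_S q_nonzero)

lemma opH_in_carrier: "x \<in> so.C \<Longrightarrow> opH q i x \<in> so.C"
  by (simp add: opH_def carrier_intros opK_in_carrier)

lemma opE_in_carrier:
  assumes "x \<in> so.C"
  shows "opE q i x \<in> so.C"
  using assms
proof (induction x rule: carrier_induct)
  case (word c w)
  then have "opE q i (word w) \<in> so.C"
    by (induction w) (simp_all add: word_Nil opE_one word_Cons opE_ncvar_mult carrier_intros opH_in_carrier)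
  then show ?case by (simp add: op_linear carrier_intros)
qed (simp_all add: op_linear carrier_intros)

lemma opE_in_S:
  assumes "x \<in> S"
  shows "opE q k x \<in> S"
  using assms
proof (induction rule: S.induct)
  case (S_word u v s c)
  have comm: "opE q k (s * m) = s * opE q k m" for m
    using S_word(3) q_nonzero opE_serre_mult opE_commutator_mult
    by (auto simp: serre_elements_def)
  \<comment> \<open>Passing the letters of \<open>u\<close> leaves \<open>opH\<close> terms, which
    stay in \<open>S\<close>; after that \<open>opE\<close> commutes with \<open>s\<close> and acts
    on \<open>word v\<close> alone.\<close>
  have "opE q k (word u * (s * word v)) \<in> S"
    using S_word(1)
  proof (induction u)
    case Nil
    then show ?case
      using S_word(2,3)
      by (simp add: word_Nil comm S_mult_right serre_in_S opE_in_carrier carrier_intros)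
  next
    case (Cons g u)
    have "word u * s * word v \<in> S"
      using S.S_word[of u v s 1] Cons.prems S_word(2,3) by simp
    then have "opH q k (word u * (s * word v)) \<in> S"
      by (simp add: opH_in_S mult.assoc)
    moreover have "ncvar g * opE q k (word u * (s * word v)) \<in> S"
      using Cons by (intro S_mult_left carrier_intros) simp_all
    ultimately show ?case
      by (auto simp: word_Cons opE_ncvar_mult mult.assoc intro: S_add)
  qed
  then show ?case by (simp add: op_linear S_sc mult.assoc)
qed (simp_all add: op_linear S.intros)

section \<open>The action of the quantum algebra modulo \<open>S\<close>\<close>

definition op :: "sl_gen \<Rightarrow> so_gen ncpoly \<Rightarrow> so_gen ncpoly" where
  "op g = (case g of gen_E i \<Rightarrow> opE q i | gen_F i \<Rightarrow> (\<lambda>m. vI (i + 1) i * m)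
    | gen_K i \<Rightarrow> opK q i | gen_Kinv i \<Rightarrow> opK (inverse q) i)"

lemma op_simps [simp]:
  "op (gen_E i) = opE q i" "op (gen_F i) = (\<lambda>m. vI (Suc i) i * m)"
  "op (gen_K i) = opK q i" "op (gen_Kinv i) = opK (inverse q) i"
  by (simp_all add: op_def)

lemma linop_op: "linop (op g)"
  by (cases g) (simp_all add: linop_opE linop_opK linop_intros)

lemma op_in_carrier: "g \<in> sl_gens n \<Longrightarrow> x \<in> so.C \<Longrightarrow> op g x \<in> so.C"
  by (auto simp: sl_gens_def opE_in_carrier opK_in_carrier so_gen_in_carrier intro!: mult_in_carrier)

lemma op_in_S: "g \<in> sl_gens n \<Longrightarrow> x \<in> S \<Longrightarrow> op g x \<in> S"
  by (auto simp: sl_gens_def opE_in_S opK_in_S q_nonzero so_gen_in_carrier intro!: S_mult_left)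

lemma act_in_carrier: "p \<in> sl.C \<Longrightarrow> m \<in> so.C \<Longrightarrow> act op p m \<in> so.C"
  by (rule act_closed[where X = so.C]) (auto intro: carrier_intros op_in_carrier)

lemma act_in_S: "p \<in> sl.C \<Longrightarrow> m \<in> S \<Longrightarrow> act op p m \<in> S"
  by (rule act_closed[where X = S]) (auto intro: S.intros S_sc op_in_S)

text \<open>Most relations hold exactly, so the difference acts as 0. The two families among the
  \<open>vF\<close> give Serre elements times \<open>m\<close>, which lie in \<open>S\<close>
  because \<open>m\<close> is in \<open>so.C\<close>.\<close>

lemma act_sl_rels:
  assumes "(l, r) \<in> sl_rels n q" "m \<in> so.C"
  shows "act op (l - r) m \<in> S"
proof -
  note act = act_mult[OF linop_op] act_linear act_ncvar act_one ncconst_eq_sc op_linear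
    opK_ncvar_mult opE_ncvar_mult
  note Kinv = opK_inverse[OF q_nonzero] opK_inverse[of "inverse q", simplified inverse_inverse_eq]
  consider
    (KL) i where "l = vK i * vKinv i" "r = 1"
  | (LK) i where "l = vKinv i * vK i" "r = 1"
  | (KK) i j where "l = vK i * vK j" "r = vK j * vK i"
  | (KE) i j where "l = vK i * vE j * vKinv i" "r = ncconst (q powi cartan i j) * vE j"
  | (KF) i j where "l = vK i * vF j * vKinv i" "r = ncconst (q powi (- cartan i j)) * vF j"
  | (EF) i j where "l = vE i * vF j - vF j * vE i"
      "r = (if i = j then ncconst (1 / (q - inverse q)) * (vK i - vKinv i) else 0)"
  | (EE) i j where "l = vE i * vE j" "r = vE j * vE i" "\<bar>int i - int j\<bar> > 1"
  | (FF) i j where "l = vF i * vF j" "r = vF j * vF i" "\<bar>int i - int j\<bar> > 1" "i \<in> {1..n-1}" "j \<in> {1..n-1}"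
  | (EEE) i j where "l = (vE i)^2 * vE j - ncconst (q + inverse q) * vE i * vE j * vE i + vE j * (vE i)^2"
      "r = 0" "\<bar>int i - int j\<bar> = 1"
  | (FFF) i j where "l = (vF i)^2 * vF j - ncconst (q + inverse q) * vF i * vF j * vF i + vF j * (vF i)^2"
      "r = 0" "\<bar>int i - int j\<bar> = 1" "i \<in> {1..n-1}" "j \<in> {1..n-1}"
    using assms(1) unfolding sl_rels_def Let_def by (elim UnE CollectE exE conjE) (simp only: prod.inject; blast)+
  then show ?thesis
  proof cases
    case KL
    then show ?thesis by (simp add: act Kinv S_zero)
  next
    case LK
    then show ?thesis using q_nonzero by (simp add: act Kinv S_zero)
  next
    case KK
    then show ?thesis by (simp add: act opK_commute[of q i] S_zero)
  next
    case KE
    then show ?thesis using q_nonzero by (simp add: act opK_opE Kinv S_zero sc_simps)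
  next
    case KF
    then show ?thesis using q_nonzero by (simp add: act Kinv S_zero sc_simps)
  next
    case EF
    then show ?thesis by (auto simp: act S_zero sc_simps opH_def)
  next
    case EE
    then show ?thesis using q_nonzero by (simp add: act opE_commute[of q i j] S_zero)
  next
    case FF
    have "(vI (i + 1) i * vI (j + 1) j - vI (j + 1) j * vI (i + 1) i) * m \<in> S"
      using FF(3-5) assms(2) by (intro S_mult_right serre_in_S) (auto simp: serre_elements_def)
    then show ?thesis by (simp add: FF(1,2) act algebra_simps)
  next
    case EEE
    then show ?thesis
      using opE_serre[OF q_nonzero EEE(3), of m] by (simp add: act S_zero power2_eq_square sc_simps)
  next
    case FFF
    have "serre q (vI (i + 1) i) (vI (j + 1) j) * m \<in> S"
      using FFF(3-5) assms(2) by (intro S_mult_right serre_in_S) (auto simp: serre_elements_def)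
    then show ?thesis
      by (simp add: FFF(1,2) act serre_def power2_eq_square algebra_simps sc_simps)
  qed
qed

lemma act_J_in_S:
  assumes "p \<in> sl.J" "m \<in> so.C"
  shows "act op p m \<in> S"
proof -
  \<comment> \<open>Quantifying over all \<open>m\<close> makes this set an ideal: a factor on the
    right moves \<open>m\<close> within \<open>so.C\<close>, a factor on the left acts on
    \<open>S\<close>.\<close>
  have "sl.J \<subseteq> {p \<in> sl.C. \<forall>m\<in>so.C. act op p m \<in> S}"
  proof (rule sl.J_minimal)
    show "l - r \<in> {p \<in> sl.C. \<forall>m\<in>so.C. act op p m \<in> S}" if "(l, r) \<in> sl_rels n q" for l r
      using that act_sl_rels sl.J_in_carrier[OF sl.rel_in_J] by blast
  qed (auto simp: act_linear act_mult[OF linop_op] S_zero S_add act_in_S act_in_carrier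
      intro: carrier_intros)
  then show ?thesis using assms by blast
qed

section \<open>The map \<open>T\<close> and leading terms\<close>

lemma degree_less_opK: "x \<in> degree_less d \<Longrightarrow> opK p i x \<in> degree_less d"
  by (induction x rule: degree_less_induct)
    (simp_all add: op_linear opK_word degree_less_zero degree_less_add degree_less_sc degree_less_word)

lemma degree_less_opE: "x \<in> degree_less d \<Longrightarrow> opE q i x \<in> degree_less d"
proof (induction x rule: degree_less_induct)
  case (word c w)
  have "opE q i (word w) \<in> degree_less (length w)"
  proof (induction w)
    case (Cons g w)
    have "opH q i (word w) \<in> degree_less (Suc (length w))"
      by (simp add: opH_def degree_less_sc degree_less_diff degree_less_opK degree_less_word)
    with Cons show ?case
      by (simp add: word_Cons opE_ncvar_mult degree_less_add degree_less_ncvar_mult)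
  qed (simp add: word_Nil opE_one degree_less_zero)
  with word show ?case
    by (simp add: op_linear degree_less_sc degree_less_mono)
qed (simp_all add: op_linear degree_less_zero degree_less_add)

definition T :: "so_gen ncpoly \<Rightarrow> so_gen ncpoly" where
  "T x = act op (subst \<beta> x) 1"

lemma T_linear:
  "T (x + y) = T x + T y" "T (x - y) = T x - T y" "T (sc c x) = sc c (T x)" "T 0 = 0"
  by (simp_all add: T_def subst_linear act_linear)

text \<open>The outermost \<open>B i\<close> acts on \<open>T (word w)\<close>: its
  \<open>vF i\<close> part prepends the letter, while its \<open>e i\<close> part does not raise the
  degree and so stays below the new length.\<close>

lemma T_word:
  "set w \<subseteq> so_gens n \<Longrightarrow> T (word w) - word w \<in> degree_less (length w)"
proof (induction w)
  case Nil
  then show ?case by (simp add: T_def word_Nil subst_one act_one degree_less_zero)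
next
  case (Cons g w)
  then obtain i where g: "g = gen_I (Suc i) i" by (auto simp: so_gens_def)
  have IH: "T (word w) - word w \<in> degree_less (length w)" using Cons by simp
  have "(T (word w) - word w) + word w \<in> degree_less (Suc (length w))"
    by (intro degree_less_add degree_less_mono[OF IH]) (simp_all add: degree_less_word)
  then have low: "T (word w) \<in> degree_less (Suc (length w))" by simp
  have "T (word (g # w)) - word (g # w) =
      ncvar g * (T (word w) - word w) - sc q (opK (inverse q) i (opE q i (T (word w))))"
    by (simp add: T_def word_Cons subst_mult subst_ncvar act_mult[OF linop_op] \<beta>_def g B_def e_def
        act_linear act_ncvar op_linear algebra_simps)
  also have "\<dots> \<in> degree_less (Suc (length w))"
    by (intro degree_less_diff degree_less_ncvar_mult[OF IH] degree_less_sc degree_less_opK degree_less_opE low)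
  finally show ?case by simp
qed

lemma T_leading:
  assumes "x \<in> so.C" "x \<in> degree_less (Suc d)"
  shows "T x - x \<in> degree_less d"
proof (induction x rule: ncpoly_induct)
  case zero
  show ?case by (simp add: T_linear degree_less_zero)
next
  case (add x y)
  then show ?case using degree_less_add[OF add] by (simp add: T_linear algebra_simps)
next
  case (word c w)
  have "\<forall>w\<in>Poly_Mapping.keys x. set (letters w) \<subseteq> so_gens n \<and> length (letters w) < Suc d"
    using assms by (simp add: free_algebra_def degree_less_def)
  then have "set (letters (Mon w)) \<subseteq> so_gens n \<and> length (letters (Mon w)) < Suc d"
    using word by (rule bspec)
  then have "T (word w) - word w \<in> degree_less d"
    by (intro degree_less_mono[OF T_word]) simp_all
  then have "sc c (T (word w) - word w) \<in> degree_less d" by (rule degree_less_sc)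
  then show ?case by (simp add: T_linear sc_simps)
qed

text \<open>The two cubic families of relations are the cases \<open>j = Suc i\<close> and
  \<open>i = Suc j\<close> of one formula whose cubic part is a Serre element.\<close>

lemma serre_in_so_J:
  assumes "i \<in> {1..n-1}" "j \<in> {1..n-1}" "\<bar>int i - int j\<bar> = 1"
  shows "serre q (vI (Suc i) i) (vI (Suc j) j) + vI (Suc j) j \<in> so.J"
proof -
  consider "j = Suc i" | "i = Suc j" using assms(3) by linarith
  then show ?thesis
  proof cases
    case 1
    then have "2 \<le> Suc i" "Suc i \<le> n - 1" using assms by auto
    then have "((vI (Suc i) (Suc i - 1))^2 * vI (Suc i + 1) (Suc i)
        - ncconst (q + inverse q) * vI (Suc i) (Suc i - 1) * vI (Suc i + 1) (Suc i) * vI (Suc i) (Suc i - 1)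
        + vI (Suc i + 1) (Suc i) * (vI (Suc i) (Suc i - 1))^2, - vI (Suc i + 1) (Suc i)) \<in> so_rels n q"
      unfolding so_rels_def by blast
    from so.rel_in_J[OF this] show ?thesis
      by (simp add: 1 serre_def ncconst_eq_sc sc_simps power2_eq_square mult.assoc)
  next
    case 2
    then have "2 \<le> Suc j" "Suc j \<le> n - 1" using assms by auto
    then have "(vI (Suc j) (Suc j - 1) * (vI (Suc j + 1) (Suc j))^2
        - ncconst (q + inverse q) * vI (Suc j + 1) (Suc j) * vI (Suc j) (Suc j - 1) * vI (Suc j + 1) (Suc j)
        + (vI (Suc j + 1) (Suc j))^2 * vI (Suc j) (Suc j - 1), - vI (Suc j) (Suc j - 1)) \<in> so_rels n q"
      unfolding so_rels_def by blast
    from so.rel_in_J[OF this] show ?thesis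
      by (simp add: 2 serre_def ncconst_eq_sc sc_simps power2_eq_square algebra_simps)
  qed
qed

lemma commutator_in_so_J:
  assumes "i \<in> {1..n-1}" "j \<in> {1..n-1}" "\<bar>int i - int j\<bar> > 1"
  shows "vI (Suc i) i * vI (Suc j) j - vI (Suc j) j * vI (Suc i) i \<in> so.J"
proof -
  have "Suc i \<in> {2..n}" "Suc j \<in> {2..n}" "\<bar>int (Suc i) - int (Suc j)\<bar> > 1"
    using assms by auto
  then have "(vI (Suc i) (Suc i - 1) * vI (Suc j) (Suc j - 1)
      - vI (Suc j) (Suc j - 1) * vI (Suc i) (Suc i - 1), 0) \<in> so_rels n q"
    unfolding so_rels_def by blast
  from so.rel_in_J[OF this] show ?thesis by simp
qed

text \<open>A spanning element of \<open>S\<close> is homogeneous, so its part of degree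
  \<open>d\<close> is itself or 0. Adding the lower term of the matching orthogonal relation turns
  it into an element of \<open>so.J\<close>.\<close>

lemma S_leading_terms:
  assumes "x \<in> S"
  shows "\<exists>r\<in>so.J. homogeneous_part d x - r \<in> degree_less d"
  using assms
proof (induction rule: S.induct)
  case S_zero
  then show ?case
    using so.J_zero by (intro bexI[of _ 0]) (simp_all add: homogeneous_part_linear degree_less_zero)
next
  case (S_add x y)
  then obtain r r' where "r \<in> so.J" "r' \<in> so.J"
    and r: "homogeneous_part d x - r \<in> degree_less d" "homogeneous_part d y - r' \<in> degree_less d"
    by blast
  then show ?case
    using so.J_add degree_less_add[OF r]
    by (intro bexI[of _ "r + r'"]) (simp_all add: homogeneous_part_linear algebra_simps)
next
  case (S_word u v s c)
  consider (serre) i j where "s = serre q (vI (Suc i) i) (vI (Suc j) j)"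
      "i \<in> {1..n-1}" "j \<in> {1..n-1}" "\<bar>int i - int j\<bar> = 1"
    | (commutator) i j where "s = vI (Suc i) i * vI (Suc j) j - vI (Suc j) j * vI (Suc i) i"
      "i \<in> {1..n-1}" "j \<in> {1..n-1}" "\<bar>int i - int j\<bar> > 1"
    using S_word(3) by (auto simp: serre_elements_def)
  then show ?case
  proof cases
    case serre
    let ?x = "gen_I (Suc i) i" and ?y = "gen_I (Suc j) j"
    let ?r = "word u * (s + ncvar ?y) * word v"
    have expand: "word u * s * word v = word (u @ [?x, ?x, ?y] @ v)
        - sc (q + inverse q) (word (u @ [?x, ?y, ?x] @ v)) + word (u @ [?y, ?x, ?x] @ v)"
      by (simp add: serre(1) serre_def word_append word_Cons word_Nil algebra_simps sc_simps)
    have hom: "homogeneous_part d (sc c (word u * s * word v)) =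
        (if d = length u + 3 + length v then sc c (word u * s * word v) else 0)"
      by (simp add: homogeneous_part_linear homogeneous_part_word expand)
    show ?thesis
    proof (cases "d = length u + 3 + length v")
      case True
      \<comment> \<open>What remains is the linear term of the relation, two letters shorter than
        the cubic part.\<close>
      have "homogeneous_part d (sc c (word u * s * word v)) - sc c ?r = sc (- c) (word (u @ [?y] @ v))"
        unfolding hom if_P[OF True]
        by (simp add: word_append word_Cons word_Nil algebra_simps sc_simps)
      moreover have "sc c ?r \<in> so.J"
        using serre_in_so_J[OF serre(2-4)] S_word(1,2) serre(1)
        by (intro so.J_sc so.J_mult_right so.J_mult_left carrier_intros) simp_all
      moreover have "sc (- c) (word (u @ [?y] @ v)) \<in> degree_less d"
        using True by (intro degree_less_sc) (simp add: degree_less_word)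
      ultimately show ?thesis by (intro bexI[of _ "sc c ?r"]) (simp_all only:)
    next
      case False
      then show ?thesis
        by (intro bexI[of _ 0]) (simp_all add: hom degree_less_zero so.J_zero)
    qed
  next
    case commutator
    let ?x = "gen_I (Suc i) i" and ?y = "gen_I (Suc j) j"
    have expand: "word u * s * word v = word (u @ [?x, ?y] @ v) - word (u @ [?y, ?x] @ v)"
      by (simp add: commutator(1) word_append word_Cons word_Nil algebra_simps)
    have hom: "homogeneous_part d (sc c (word u * s * word v)) =
        (if d = length u + 2 + length v then sc c (word u * s * word v) else 0)"
      by (simp add: homogeneous_part_linear homogeneous_part_word expand)
    moreover have "sc c (word u * s * word v) \<in> so.J"
      using commutator_in_so_J[OF commutator(2-4)] S_word(1,2) commutator(1)
      by (intro so.J_sc so.J_mult_right so.J_mult_left carrier_intros) simp_all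
    ultimately have "homogeneous_part d (sc c (word u * s * word v)) \<in> so.J"
      by (simp add: so.J_zero)
    then show ?thesis by (rule bexI[rotated]) (simp add: degree_less_zero)
  qed
qed

lemma subst_so_J: "r \<in> so.J \<Longrightarrow> subst \<beta> r \<in> sl.J"
  by (rule alg_hom_of_subst[OF so.presentation_axioms sl.presentation_axioms \<beta>_in_carrier subst_so_rels])

lemma T_in_S_imp_J:
  assumes "x \<in> so.C" "T x \<in> S"
  shows "x \<in> so.J"
proof -
  have "x \<in> so.C \<Longrightarrow> T x \<in> S \<Longrightarrow> x \<in> degree_less d \<Longrightarrow> x \<in> so.J" for d x
  proof (induction d arbitrary: x)
    case 0
    then show ?case using degree_less_0 so.J_zero by blast
  next
    case (Suc d)
    obtain r where r: "r \<in> so.J" "homogeneous_part d (T x) - r \<in> degree_less d"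
      using S_leading_terms[OF Suc.prems(2)] by blast
    have lead: "T x - x \<in> degree_less d" by (rule T_leading) fact+
    have "(T x - x) + x \<in> degree_less (Suc d)"
      using Suc.prems(3) by (intro degree_less_add degree_less_mono[OF lead]) simp_all
    then have "T x - homogeneous_part d (T x) \<in> degree_less d"
      by (intro diff_homogeneous_part) simp
    \<comment> \<open>The three low-degree differences combine to \<open>x - r\<close>: subtracting
      an element of the ideal has removed the leading part of \<open>x\<close>.\<close>
    from degree_less_diff[OF degree_less_add[OF this r(2)] lead] have "x - r \<in> degree_less d" by simp
    \<comment> \<open>Elements of \<open>so.J\<close> are sent into \<open>sl.J\<close>, which maps
      1 into \<open>S\<close>; hence \<open>x - r\<close> inherits the hypothesis on
      \<open>x\<close>.\<close>
    moreover have "T r \<in> S"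
      unfolding T_def by (intro act_J_in_S subst_so_J r(1) carrier_intros)
    moreover have "x - r \<in> so.C"
      using Suc.prems(1) r(1) by (rule diff_in_carrier[OF _ so.J_in_carrier])
    ultimately have "x - r \<in> so.J"
      using Suc.prems(2) by (intro Suc.IH) (simp_all add: T_linear S_diff)
    then show ?case using r(1) by (rule so.J_sub_closed)
  qed
  \<comment> \<open>For \<open>x = 0\<close> the maximum is over the empty set, but then there are
    no words to bound.\<close>
  moreover have "x \<in> degree_less (Suc (Max ((length \<circ> letters) ` Poly_Mapping.keys x)))"
    by (auto simp: degree_less_def less_Suc_eq_le intro!: Max_ge)
  ultimately show ?thesis using assms by blast
qed

lemma I_tilde_eq: "1 \<le> i \<Longrightarrow> i \<le> n - 1 \<Longrightarrow> I_tilde n q i = sl.coset (B i)"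
  unfolding I_tilde_def Usl_def Usl_F_def Usl_E_def Usl_Kinv_def
  by (simp add: sl.coset_mult sl.coset_smult sl.coset_minus B_def e_def carrier_intros)

end

section \<open>Existence, uniqueness and injectivity of the embedding\<close>

theorem theorem3:
  fixes n :: nat and q :: complex
  assumes "n \<ge> 2" and "q \<noteq> 0" and "q^2 \<noteq> 1"
  shows "\<exists>\<phi> \<in> alg_hom (Uso n q) (Usl n q).
           (\<forall>i \<in> {1..n-1}. \<phi> (Uso_I n q (i+1) i) = I_tilde n q i)
         \<and> (\<forall>\<psi> \<in> alg_hom (Uso n q) (Usl n q).
              (\<forall>i \<in> {1..n-1}. \<psi> (Uso_I n q (i+1) i) = I_tilde n q i)
                \<longrightarrow> (\<forall>x \<in> carrier (Uso n q). \<psi> x = \<phi> x))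
         \<and> inj_on \<phi> (carrier (Uso n q))
         \<and> unital_subalgebra (\<phi> ` carrier (Uso n q)) (Usl n q)
         \<and> \<phi> \<in> alg_iso (Uso n q) ((Usl n q)\<lparr>carrier := \<phi> ` carrier (Uso n q)\<rparr>)"
proof -
  interpret quantum_parameter n q
    by unfold_locales (fact assms)+
  obtain \<phi> where hom: "\<phi> \<in> alg_hom so.Q sl.Q"
    and \<phi>: "\<And>p. p \<in> so.C \<Longrightarrow> \<phi> (so.coset p) = sl.coset (subst \<beta> p)"
  proof (rule alg_hom_of_subst[OF so.presentation_axioms sl.presentation_axioms \<beta>_in_carrier subst_so_rels])
    fix f assume "f \<in> alg_hom so.Q sl.Q"
      and "\<And>p. p \<in> so.C \<Longrightarrow> f (so.coset p) = sl.coset (subst \<beta> p)"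
    then show thesis by (rule that)
  qed
  have ring_hom: "\<phi> \<in> ring_hom so.Q sl.Q"
    and smult: "\<And>c x. x \<in> carrier so.Q \<Longrightarrow> \<phi> (c \<odot>\<^bsub>so.Q\<^esub> x) = c \<odot>\<^bsub>sl.Q\<^esub> \<phi> x"
    using hom by (auto simp: alg_hom_def)
  have on_gens: "\<phi> (Uso_I n q (i+1) i) = I_tilde n q i" if "i \<in> {1..n-1}" for i
    using that by (simp add: Uso_I_def \<phi> so_gen_in_carrier subst_ncvar \<beta>_def I_tilde_eq)
  have unique: "\<psi> x = \<phi> x" if \<psi>: "\<psi> \<in> alg_hom so.Q sl.Q"
    "\<forall>i\<in>{1..n-1}. \<psi> (Uso_I n q (i+1) i) = I_tilde n q i" and "x \<in> carrier so.Q" for \<psi> x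
  proof (rule alg_hom_cosets_unique[OF so.presentation_axioms sl.presentation_axioms \<psi>(1) hom])
    fix g assume "g \<in> so_gens n"
    then obtain i where "i \<in> {1..n-1}" "g = gen_I (i + 1) i" by (auto simp: so_gens_def)
    then show "\<psi> (so.coset (ncvar g)) = \<phi> (so.coset (ncvar g))"
      using \<psi>(2) on_gens unfolding Uso_I_def by simp
  qed fact
  have inj: "inj_on \<phi> (carrier so.Q)"
  proof (rule inj_onI)
    fix x y assume xy: "x \<in> carrier so.Q" "y \<in> carrier so.Q" "\<phi> x = \<phi> y"
    then obtain p r where p: "p \<in> so.C" "x = so.coset p" and r: "r \<in> so.C" "y = so.coset r"
      by (auto simp: so.carrier_presented)
    have "subst \<beta> p \<in> sl.C" "subst \<beta> r \<in> sl.C"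
      using p r by (simp_all add: subst_in_carrier \<beta>_in_carrier)
    then have "subst \<beta> (p - r) \<in> sl.J"
      using xy(3) p r by (simp add: \<phi> sl.coset_eq_iff subst_linear)
    \<comment> \<open>Equality of the images enters here: an element of \<open>sl.J\<close> applied
      to the vector 1 lands in \<open>S\<close>.\<close>
    then have "T (p - r) \<in> S"
      unfolding T_def by (intro act_J_in_S carrier_intros)
    then have "p - r \<in> so.J"
      using p(1) r(1) by (intro T_in_S_imp_J diff_in_carrier)
    then show "x = y"
      using p r by (simp add: so.coset_eq_iff)
  qed
  interpret \<phi>: ring_hom_ring so.Q sl.Q \<phi>
    by (rule ring_hom_ringI2[OF so.ring_presented sl.ring_presented ring_hom])
  have sub: "unital_subalgebra (\<phi> ` carrier so.Q) sl.Q"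
    unfolding unital_subalgebra_def
  proof (intro conjI allI ballI)
    show "subring (\<phi> ` carrier so.Q) sl.Q"
      by (rule \<phi>.img_is_subring[OF \<phi>.R.carrier_is_subring])
    fix c y assume "y \<in> \<phi> ` carrier so.Q"
    then obtain p where p: "p \<in> so.C" "y = \<phi> (so.coset p)"
      by (auto simp: so.carrier_presented)
    then have "c \<odot>\<^bsub>sl.Q\<^esub> y = \<phi> (so.coset (sc c p))"
      by (simp add: so.coset_in_carrier so.coset_smult flip: smult)
    then show "c \<odot>\<^bsub>sl.Q\<^esub> y \<in> \<phi> ` carrier so.Q"
      using p(1) by (simp add: so.coset_in_carrier carrier_intros)
  qed
  have iso: "\<phi> \<in> alg_iso so.Q (sl.Q\<lparr>carrier := \<phi> ` carrier so.Q\<rparr>)"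
    using inj ring_hom smult
    by (auto simp: alg_iso_def alg_hom_def ring_hom_def bij_betw_def)
  show ?thesis
    unfolding Uso_def Usl_def
    by (intro bexI[OF _ hom] conjI ballI impI inj sub iso) (rule on_gens unique; assumption)+
qed

end
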